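(* Let $\pi$ be a triod twist pattern with rotation number $\rho>\frac13$, the branches of the triod $T$ being numbered canonically for $\pi$. Then $\pi$ has no green points (i.e. no cycle exhibiting $\pi$ has a green point).
   Context: The triod is $T=\{z\in\mathbb{C}: z^3\in[0,1]\}$, with central (branching) point $a=0$; the branches of $T$ are the three components of $T\setminus\{a\}$. Let $\mathcal{U}$ be the set of continuous maps $f:T\to T$ for which $a$ is the unique fixed point. A cycle is a periodic orbit $P\neq\{a\}$ of some $f\in\mathcal{U}$; $[P]$ is its convex hull in $T$. Cycles $P$ of $f$ and $Q$ of $g$ are equivalent if there is a homeomorphism $h:[P]\to[Q]$ with $h(P)=Q$ and $h\circ f=g\circ h$ on $P$, which fixes branches (points of each branch are sent into the same branch). The equivalence class of $P$ is its pattern, and $P$ exhibits that pattern. A pattern $A$ forces a pattern $B$ if every $f\in\mathcal{U}$ with a cycle of pattern $A$ also has a cycle of pattern $B$. A cycle and its pattern are primitive if each point of the cycle lies on a different branch. A pattern is regular if it does not force a primitive pattern of period $2$; a cycle is regular if its pattern is. Number the branches $b_0,b_1,b_2$ (indices mod $3$). For $u\in b_i$, $v\in b_j$ put $d(u,v)=\frac k3$, where $k\in\{0,1,2\}$ and $j\equiv i+k \pmod 3$. For a cycle $P$ of $f$, a point $x\in P$ is green, black or red according as $d(x,f(x))=0,\frac13,\frac23$. If $P$ has period $n$, its rotation pair is $\left(\sum_{i=0}^{n-1}d(f^i(x),f^{i+1}(x)),\,n\right)$ for $x\in P$ (the first entry is an integer), and its rotation number is the quotient of the first entry by the second; these depend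 only on the pattern. The numbering is canonical for a regular cycle (or its pattern) if, for each $i$, the point of the cycle on $b_i$ closest to $a$ is black; every regular cycle admits a canonical numbering. All rotation numbers are computed with the fixed numbering. A triod twist is a regular pattern that does not force another pattern with the same rotation number. *)

theory Defs
  imports "HOL-Analysis.Analysis" "HOL-Combinatorics.Orbits"
begin

definition triod :: "complex set" where
  "triod = {z. z ^ 3 \<in> complex_of_real ` {0..1}}"

definition branches :: "complex set set" where
  "branches = components (triod - {0})"

text \<open>Maps are total functions on the complex plane; only their restriction to the triod matters.\<close>

definition triod_maps :: "(complex \<Rightarrow> complex) set" where
  "triod_maps = {f. continuous_on triod f \<and> f ` triod \<subseteq> triod \<and> {x \<in> triod. f x = x} = {0}}"

text \<open>The convex hull in the tree \<open>triod\<close> (the smallest connected subset of the triod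
  containing \<open>P\<close>), which is not the convex hull in the plane.\<close>

definition triod_hull :: "complex set \<Rightarrow> complex set" where
  "triod_hull P = \<Inter>{C. C \<subseteq> triod \<and> connected C \<and> P \<subseteq> C}"

text \<open>A cycle is recorded together with its map. \<open>cyclic_on f P\<close> says that \<open>P\<close> is a
  periodic orbit of \<open>f\<close>: \<open>P\<close> has an element \<open>s\<close> with \<open>P = orbit f s\<close>, where \<open>orbit f s\<close>
  consists of the iterates \<open>(f ^^ n) s\<close> with \<open>n > 0\<close>.\<close>

type_synonym cycle = "(complex \<Rightarrow> complex) \<times> complex set"

definition cycles :: "cycle set" where
  "cycles = {(f, P). f \<in> triod_maps \<and> P \<subseteq> triod \<and> cyclic_on f P \<and> P \<noteq> {0}}"

definition cycle_equiv :: "(cycle \<times> cycle) set" where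
  "cycle_equiv = {((f, P), (g, Q)). (f, P) \<in> cycles \<and> (g, Q) \<in> cycles \<and>
     (\<exists>h k. homeomorphism (triod_hull P) (triod_hull Q) h k \<and> h ` P = Q \<and>
            (\<forall>x\<in>P. h (f x) = g (h x)) \<and>
            (\<forall>B\<in>branches. h ` (triod_hull P \<inter> B) \<subseteq> B))}"

text \<open>A cycle \<open>P\<close> of \<open>f\<close> exhibits the pattern \<open>A\<close> iff \<open>(f, P) \<in> A\<close>.\<close>

definition patterns :: "cycle set set" where
  "patterns = cycles // cycle_equiv"

definition forces :: "cycle set \<Rightarrow> cycle set \<Rightarrow> bool" where
  "forces A B \<longleftrightarrow> (\<forall>f\<in>triod_maps. (\<exists>P. (f, P) \<in> A) \<longrightarrow> (\<exists>Q. (f, Q) \<in> B))"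

definition primitive :: "cycle set \<Rightarrow> bool" where
  "primitive A \<longleftrightarrow>
     (\<forall>(f, P)\<in>A. \<forall>x\<in>P. \<forall>y\<in>P. \<forall>B\<in>branches. x \<in> B \<and> y \<in> B \<longrightarrow> x = y)"

definition has_period :: "cycle set \<Rightarrow> nat \<Rightarrow> bool" where
  "has_period A n \<longleftrightarrow> (\<forall>(f, P)\<in>A. card P = n)"

definition regular :: "cycle set \<Rightarrow> bool" where
  "regular A \<longleftrightarrow> \<not> (\<exists>B\<in>patterns. primitive B \<and> has_period B 2 \<and> forces A B)"

definition branch_numbering :: "(nat \<Rightarrow> complex set) \<Rightarrow> bool" where
  "branch_numbering b \<longleftrightarrow> bij_betw b {..<3} branches"

definition branch_dist :: "(nat \<Rightarrow> complex set) \<Rightarrow> complex \<Rightarrow> complex \<Rightarrow> real" where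
  "branch_dist b u v = real (THE k. k < 3 \<and> (\<exists>i<3. u \<in> b i \<and> v \<in> b ((i + k) mod 3))) / 3"

definition green :: "(nat \<Rightarrow> complex set) \<Rightarrow> (complex \<Rightarrow> complex) \<Rightarrow> complex \<Rightarrow> bool" where
  "green b f x \<longleftrightarrow> branch_dist b x (f x) = 0"

definition black :: "(nat \<Rightarrow> complex set) \<Rightarrow> (complex \<Rightarrow> complex) \<Rightarrow> complex \<Rightarrow> bool" where
  "black b f x \<longleftrightarrow> branch_dist b x (f x) = 1 / 3"

definition rotation_pair ::
  "(nat \<Rightarrow> complex set) \<Rightarrow> (complex \<Rightarrow> complex) \<Rightarrow> complex set \<Rightarrow> complex \<Rightarrow> real \<times> nat" where
  "rotation_pair b f P x =
     (\<Sum>i<card P. branch_dist b ((f ^^ i) x) ((f ^^ Suc i) x), card P)"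

text \<open>The quotient does not depend on the cycle exhibiting the pattern nor on its base point;
  see \<open>rotation_number_eq\<close> below.\<close>

definition rotation_number :: "(nat \<Rightarrow> complex set) \<Rightarrow> cycle set \<Rightarrow> real" where
  "rotation_number b A =
     (THE \<rho>. \<forall>(f, P)\<in>A. \<forall>x\<in>P. \<rho> = fst (rotation_pair b f P x) / real (snd (rotation_pair b f P x)))"

text \<open>Distance to the branching point along the triod is the modulus.\<close>

definition canonical :: "(nat \<Rightarrow> complex set) \<Rightarrow> cycle set \<Rightarrow> bool" where
  "canonical b A \<longleftrightarrow>
     (\<forall>(f, P)\<in>A. \<forall>i<3. \<exists>x\<in>P \<inter> b i. (\<forall>y\<in>P \<inter> b i. cmod x \<le> cmod y) \<and> black b f x)"

definition triod_twist :: "(nat \<Rightarrow> complex set) \<Rightarrow> cycle set \<Rightarrow> bool" where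
  "triod_twist b A \<longleftrightarrow> A \<in> patterns \<and> regular A \<and>
     \<not> (\<exists>B\<in>patterns. B \<noteq> A \<and> forces A B \<and> rotation_number b B = rotation_number b A)"

lemma orbit_notin_fixed:
  assumes "(f, P) \<in> cycles"
  shows "P \<subseteq> triod - {0}" "f ` P = P"
proof -
  from assms have f: "f \<in> triod_maps" "P \<subseteq> triod" "cyclic_on f P" "P \<noteq> {0}"
    by (auto simp: cycles_def)
  have "f 0 = 0" using f(1) by (auto simp: triod_maps_def)
  then have "orbit f 0 = {0}" by (simp add: orbit_eq_singleton_iff)
  then have "0 \<notin> P" using f(3,4) by (metis cyclic_on_alldef)
  then show "P \<subseteq> triod - {0}" using f by auto
  show "f ` P = P"
  proof
    show "f ` P \<subseteq> P" using f(3) unfolding cyclic_on_alldef by (blast intro: orbit.intros(1))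
    show "P \<subseteq> f ` P"
    proof
      fix y assume y: "y \<in> P"
      then have "y \<in> orbit f y" using f(3) unfolding cyclic_on_alldef by blast
      then show "y \<in> f ` P"
      proof cases
        case base then show ?thesis using y by blast
      next
        case (step z)
        have "z \<in> P" using step(2) y f(3) unfolding cyclic_on_alldef by blast
        then show ?thesis using step(1) by blast
      qed
    qed
  qed
qed

lemma triod_hull_zero_iff:
  assumes "(f, P) \<in> cycles"
  shows "0 \<in> triod_hull P \<longleftrightarrow> \<not> (\<exists>B\<in>branches. P \<subseteq> B)"
proof
  assume 0: "0 \<in> triod_hull P"
  show "\<not> (\<exists>B\<in>branches. P \<subseteq> B)"
  proof
    assume "\<exists>B\<in>branches. P \<subseteq> B"
    then obtain B where B: "B \<in> components (triod - {0})" "P \<subseteq> B" by (auto simp: branches_def)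
    then have "connected B" "B \<subseteq> triod - {0}"
      using in_components_connected in_components_subset by blast+
    then have "0 \<in> B" using 0 B by (auto simp: triod_hull_def)
    then show False using \<open>B \<subseteq> triod - {0}\<close> by auto
  qed
next
  assume n: "\<not> (\<exists>B\<in>branches. P \<subseteq> B)"
  have P: "P \<subseteq> triod - {0}" "P \<noteq> {}"
    using orbit_notin_fixed[OF assms] assms by (auto simp: cycles_def cyclic_on_def)
  show "0 \<in> triod_hull P"
    unfolding triod_hull_def
  proof clarsimp
    fix C assume C: "C \<subseteq> triod" "connected C" "P \<subseteq> C"
    show "0 \<in> C"
    proof (rule ccontr)
      assume "0 \<notin> C"
      then have "C \<subseteq> triod - {0}" using C by auto
      moreover have "C \<noteq> {}" using C P by auto
      ultimately obtain B where "B \<in> components (triod - {0})" "C \<subseteq> B"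
        using C exists_component_superset[of C "triod - {0}"] by auto
      then show False using n C(3) unfolding branches_def by blast
    qed
  qed
qed

lemma branches_Union: "\<Union>branches = triod - {0}"
  by (simp add: branches_def)

lemma branches_disjoint: "B \<in> branches \<Longrightarrow> C \<in> branches \<Longrightarrow> x \<in> B \<Longrightarrow> x \<in> C \<Longrightarrow> B = C"
  unfolding branches_def using components_nonoverlap by blast

lemma triod_hull_subset:
  assumes "(f, P) \<in> cycles" shows "P \<subseteq> triod_hull P" "triod_hull P \<subseteq> triod"
proof -
  show "P \<subseteq> triod_hull P" by (auto simp: triod_hull_def)
  have "z \<in> triod" if z: "z \<in> closed_segment 0 w" and w: "w \<in> triod" for z w
  proof -
    from z obtain u where u: "0 \<le> u" "u \<le> 1" "z = of_real u * w"
      by (auto simp: in_segment scaleR_conv_of_real)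
    from w obtain t where t: "0 \<le> t" "t \<le> 1" "w ^ 3 = of_real t" by (auto simp: triod_def)
    have "z ^ 3 = of_real (u ^ 3 * t)" using u t by (simp add: power_mult_distrib)
    moreover have "0 \<le> u ^ 3 * t" "u ^ 3 * t \<le> 1" using u t by (auto intro: mult_le_one power_le_one)
    ultimately show ?thesis unfolding triod_def by (auto intro: image_eqI[of _ _ "u ^ 3 * t"])
  qed
  then have "starlike triod" unfolding starlike_def
    by (intro bexI[of _ 0]) (auto simp: triod_def intro: image_eqI[of _ _ 0])
  then have "connected triod" by (simp add: starlike_imp_connected)
  then show "triod_hull P \<subseteq> triod"
    using orbit_notin_fixed(1)[OF assms] by (auto simp: triod_hull_def)
qed

lemma equiv_cycle_equiv: "equiv cycles cycle_equiv"
proof (intro equivI)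
  show "cycle_equiv \<subseteq> cycles \<times> cycles" by (auto simp: cycle_equiv_def)
  show "refl_on cycles cycle_equiv"
    by (rule refl_onI) (auto simp: cycle_equiv_def intro!: exI[of _ id] homeomorphism_ident[folded id_def])
  show "sym cycle_equiv"
  proof (rule symI)
    fix c d assume "(c, d) \<in> cycle_equiv"
    then obtain f P g Q h k where eq: "c = (f, P)" "d = (g, Q)"
      and cyc: "(f, P) \<in> cycles" "(g, Q) \<in> cycles"
      and hom: "homeomorphism (triod_hull P) (triod_hull Q) h k" and hP: "h ` P = Q"
      and conj: "\<forall>x\<in>P. h (f x) = g (h x)"
      and br: "\<forall>B\<in>branches. h ` (triod_hull P \<inter> B) \<subseteq> B"
      by (auto simp: cycle_equiv_def)
    note PH = triod_hull_subset[OF cyc(1)] and QH = triod_hull_subset[OF cyc(2)]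
    have kh: "\<And>x. x \<in> triod_hull P \<Longrightarrow> k (h x) = x" and hk: "\<And>y. y \<in> triod_hull Q \<Longrightarrow> h (k y) = y"
      and kQ: "k ` triod_hull Q = triod_hull P"
      using hom by (auto simp: homeomorphism_def)
    have kQP: "k ` Q = P" using kh PH hP by (force simp: image_iff)
    have conj': "k (g y) = f (k y)" if y: "y \<in> Q" for y
    proof -
      obtain x where x: "x \<in> P" "y = h x" using y hP by auto
      then have "f x \<in> P" using orbit_notin_fixed(2)[OF cyc(1)] by auto
      then have "k (h (f x)) = f x" "k (h x) = x" using x kh PH by auto
      then show ?thesis using x conj by auto
    qed
    have ne0: "k y \<noteq> 0" if y: "y \<in> triod_hull Q" "y \<noteq> 0" for y
    proof
      assume k0: "k y = 0"
      then have "0 \<in> triod_hull P" using y kQ by force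
      then have nP: "\<not> (\<exists>B\<in>branches. P \<subseteq> B)" using triod_hull_zero_iff[OF cyc(1)] by auto
      have "\<not> (\<exists>B\<in>branches. Q \<subseteq> B)"
      proof
        assume "\<exists>B\<in>branches. Q \<subseteq> B"
        then obtain B where B: "B \<in> branches" "Q \<subseteq> B" by auto
        have "x \<in> B" if x: "x \<in> P" for x
        proof -
          obtain C where C: "C \<in> branches" "x \<in> C"
            using x orbit_notin_fixed(1)[OF cyc(1)] branches_Union by blast
          then have "h x \<in> C" using br PH x by blast
          moreover have "h x \<in> B" using x hP B by blast
          ultimately show ?thesis using branches_disjoint B C by metis
        qed
        then show False using nP B by auto
      qed
      then have 0: "0 \<in> triod_hull Q" using triod_hull_zero_iff[OF cyc(2)] by auto
      have "k 0 \<noteq> 0" using hk[OF 0] hk[OF y(1)] k0 y(2) by auto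
      moreover have kT: "k 0 \<in> triod_hull P" using kQ 0 by auto
      ultimately obtain C where "C \<in> branches" "k 0 \<in> C"
        using PH branches_Union by blast
      then have "h (k 0) \<in> C" "0 \<notin> C" using br kT branches_Union by blast+
      then show False using hk[OF 0] by auto
    qed
    have br': "k ` (triod_hull Q \<inter> B) \<subseteq> B" if B: "B \<in> branches" for B
    proof clarify
      fix y assume y: "y \<in> triod_hull Q" "y \<in> B"
      then have "y \<noteq> 0" using B branches_Union by blast
      then have "k y \<in> triod - {0}" using ne0 y kQ PH by auto
      then obtain C where C: "C \<in> branches" "k y \<in> C" using branches_Union by blast
      moreover have "k y \<in> triod_hull P" using y kQ by auto
      ultimately have "h (k y) \<in> C" using br by blast
      then show "k y \<in> B" using hk y branches_disjoint B C by metis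
    qed
    show "(d, c) \<in> cycle_equiv"
      unfolding cycle_equiv_def eq using cyc hom kQP conj' br' homeomorphism_symD by blast
  qed
  show "trans cycle_equiv"
  proof (rule transI)
    fix c d e assume "(c, d) \<in> cycle_equiv" "(d, e) \<in> cycle_equiv"
    then obtain f P g Q h k f' P' h' k' where eq: "c = (f, P)" "d = (g, Q)" "e = (f', P')"
      and cyc: "(f, P) \<in> cycles" "(g, Q) \<in> cycles" "(f', P') \<in> cycles"
      and 1: "homeomorphism (triod_hull P) (triod_hull Q) h k" "h ` P = Q"
        "\<forall>x\<in>P. h (f x) = g (h x)" "\<forall>B\<in>branches. h ` (triod_hull P \<inter> B) \<subseteq> B"
      and 2: "homeomorphism (triod_hull Q) (triod_hull P') h' k'" "h' ` Q = P'"
        "\<forall>x\<in>Q. h' (g x) = f' (h' x)" "\<forall>B\<in>branches. h' ` (triod_hull Q \<inter> B) \<subseteq> B"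
      by (auto simp: cycle_equiv_def)
    have "h ` triod_hull P = triod_hull Q" using 1 by (auto simp: homeomorphism_def)
    then have "\<forall>B\<in>branches. (h' \<circ> h) ` (triod_hull P \<inter> B) \<subseteq> B"
      using 1(4) 2(4) by (simp add: image_subset_iff) blast
    moreover have "(h' \<circ> h) ` P = P'" "\<forall>x\<in>P. (h' \<circ> h) (f x) = f' ((h' \<circ> h) x)"
      using 1 2 by auto
    ultimately show "(c, e) \<in> cycle_equiv"
      unfolding cycle_equiv_def eq using cyc homeomorphism_compose[OF 1(1) 2(1)] by blast
  qed
qed

lemma rotation_pair_sum:
  assumes c: "(f, P) \<in> cycles" and x: "x \<in> P"
  shows "rotation_pair b f P x = (\<Sum>y\<in>P. branch_dist b y (f y), card P)"
proof -
  have per: "x \<in> orbit f x" and P: "P = orbit f x"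
    using c x unfolding cycles_def cyclic_on_alldef by blast+
  let ?n = "funpow_dist1 f x x"
  have im: "P = (\<lambda>n. (f ^^ n) x) ` {..<?n}"
    using orbit_conv_funpow_dist1[OF per] P by (simp add: atLeast0LessThan)
  have inj: "inj_on (\<lambda>n. (f ^^ n) x) {..<?n}"
    using inj_on_funpow_dist1[OF per] by (simp add: atLeast0LessThan)
  have "card P = ?n" using card_image[OF inj] im by simp
  then show ?thesis
    unfolding rotation_pair_def using im by (auto simp: sum.reindex[OF inj])
qed

lemma branch_dist_cong:
  assumes "branch_numbering b" "u \<in> triod - {0}" "v \<in> triod - {0}"
    and "\<And>B. B \<in> branches \<Longrightarrow> u \<in> B \<Longrightarrow> u' \<in> B" "\<And>B. B \<in> branches \<Longrightarrow> v \<in> B \<Longrightarrow> v' \<in> B"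
  shows "branch_dist b u' v' = branch_dist b u v"
proof -
  have b: "b i \<in> branches" if "i < 3" for i
    using assms(1) that by (auto simp: branch_numbering_def bij_betw_def)
  have *: "w \<in> b i \<longleftrightarrow> w' \<in> b i"
    if i: "i < 3" and w: "w \<in> triod - {0}" and w': "\<forall>B. B \<in> branches \<longrightarrow> w \<in> B \<longrightarrow> w' \<in> B" for i w w'
  proof -
    obtain C where "C \<in> branches" "w \<in> C" using w branches_Union by blast
    then show ?thesis using w' b[OF i] branches_disjoint by metis
  qed
  have "(k < 3 \<and> (\<exists>i<3. u' \<in> b i \<and> v' \<in> b ((i + k) mod 3))) \<longleftrightarrow>
        (k < 3 \<and> (\<exists>i<3. u \<in> b i \<and> v \<in> b ((i + k) mod 3)))" for k
  proof -
    have u: "u' \<in> b i \<longleftrightarrow> u \<in> b i" and v: "v' \<in> b i \<longleftrightarrow> v \<in> b i" if "i < 3" for i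
      using *[OF that, of u u'] *[OF that, of v v'] assms(2-5) by blast+
    have "(i + k) mod 3 < 3" for i by simp
    then show ?thesis using u v by blast
  qed
  then show ?thesis by (simp add: branch_dist_def)
qed

lemma rotation_number_eq:
  assumes b: "branch_numbering b" and A: "A \<in> patterns" and fP: "(f, P) \<in> A" and x: "x \<in> P"
  shows "rotation_number b A = fst (rotation_pair b f P x) / real (snd (rotation_pair b f P x))"
proof -
  have same: "rotation_pair b g Q y = rotation_pair b f P x" if gQ: "(g, Q) \<in> A" and y: "y \<in> Q" for g Q y
  proof -
    have "((f, P), (g, Q)) \<in> cycle_equiv"
      using A fP gQ equiv_cycle_equiv quotient_eq_iff unfolding patterns_def by metis
    then obtain h k where cyc: "(f, P) \<in> cycles" "(g, Q) \<in> cycles"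
      and hom: "homeomorphism (triod_hull P) (triod_hull Q) h k" and hP: "h ` P = Q"
      and conj: "\<forall>x\<in>P. h (f x) = g (h x)"
      and br: "\<forall>B\<in>branches. h ` (triod_hull P \<inter> B) \<subseteq> B"
      by (auto simp: cycle_equiv_def)
    note PH = triod_hull_subset[OF cyc(1)]
    have inj: "inj_on h P"
      by (rule inj_on_inverseI[of _ k]) (use hom PH(1) in \<open>auto simp: homeomorphism_def\<close>)
    have "branch_dist b (h z) (g (h z)) = branch_dist b z (f z)" if z: "z \<in> P" for z
    proof -
      have fz: "f z \<in> P" using orbit_notin_fixed(2)[OF cyc(1)] z by auto
      have "branch_dist b (h z) (h (f z)) = branch_dist b z (f z)"
      proof (rule branch_dist_cong[OF b])
        show "z \<in> triod - {0}" "f z \<in> triod - {0}"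
          using z fz orbit_notin_fixed(1)[OF cyc(1)] by blast+
        show "h z \<in> B" if "B \<in> branches" "z \<in> B" for B using that z br PH(1) by blast
        show "h (f z) \<in> B" if "B \<in> branches" "f z \<in> B" for B using that fz br PH(1) by blast
      qed
      then show ?thesis using conj z by simp
    qed
    then have "(\<Sum>y\<in>Q. branch_dist b y (g y)) = (\<Sum>z\<in>P. branch_dist b z (f z))"
      using hP sum.reindex[OF inj, of "\<lambda>y. branch_dist b y (g y)"] by simp
    moreover have "card Q = card P" using hP card_image[OF inj] by simp
    ultimately show ?thesis
      using rotation_pair_sum[OF cyc(1) x] rotation_pair_sum[OF cyc(2) y] by simp
  qed
  show ?thesis
    unfolding rotation_number_def
  proof (rule the_equality)
    show "\<forall>(g, Q)\<in>A. \<forall>y\<in>Q. fst (rotation_pair b f P x) / real (snd (rotation_pair b f P x)) =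
            fst (rotation_pair b g Q y) / real (snd (rotation_pair b g Q y))"
      using same by auto
  qed (use fP x in blast)
qed

end

theory Submission
  imports Defs
begin

text \<open>Suppose that the cycle \<open>P\<close> of \<open>f\<close> has pattern \<open>\<pi>\<close> and a green point \<open>x\<close>. As the point of
  \<open>P\<close> closest to \<open>0\<close> on the branch of \<open>x\<close> is black, \<open>f x\<close> is closer to \<open>0\<close> than \<open>x\<close>; otherwise
  \<open>f\<close> would have a second fixed point. Consider loops in \<open>P\<close> whose steps lead from \<open>y\<close> to a point
  of the segment from \<open>0\<close> to \<open>f y\<close>. The three closest points form a loop of rotation number \<open>1/3\<close>,
  and \<open>P\<close> without the green point \<open>x\<close> is a loop of rotation number larger than \<open>\<rho> > 1/3\<close>, because
  it has the same rotation with one step less. Going around both suitably often gives a loop of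
  rotation number exactly \<open>\<rho>\<close>.

  Replace this loop by the least path \<open>d\<close> with the same sequence of branches. Pulling the points of
  \<open>d\<close> back along last preimages, which are strictly monotone in the target, yields in the limit a
  periodic orbit \<open>t\<close> with \<open>t i\<close> between \<open>d i\<close> and the preceding point of \<open>P\<close>. The order of the
  points \<open>t i\<close> is the lexicographic order of the shifts of \<open>d\<close>, so the pattern of \<open>t\<close> depends only
  on \<open>\<pi>\<close> and is forced by it. If it were \<open>\<pi>\<close> again, an order isomorphism from \<open>P\<close> to \<open>t\<close> would
  make \<open>d\<close> an orbit of \<open>f\<close>; then the three closest points would form a cycle without green points.\<close>

subsection \<open>Geometry of the triod\<close>

lemma sgn_norm_eqI: "sgn x = sgn y \<Longrightarrow> cmod x = cmod y \<Longrightarrow> x = y"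
  by (metis sgn_div_norm scaleR_cancel_left inverse_nonzero_iff_nonzero norm_eq_zero)

lemma triod_iff: "z \<in> triod \<longleftrightarrow> z = 0 \<or> sgn z ^ 3 = 1 \<and> cmod z \<le> 1"
proof (cases "z = 0")
  case True
  then show ?thesis by (auto simp: triod_def intro: image_eqI[of _ _ 0])
next
  case False
  have z3: "z ^ 3 = of_real (cmod z ^ 3) * sgn z ^ 3"
    using False by (simp add: sgn_div_norm scaleR_conv_of_real power_mult_distrib flip: of_real_power)
      (simp add: field_simps)
  show ?thesis
  proof
    assume "z \<in> triod"
    then obtain t where t: "0 \<le> t" "t \<le> 1" "z ^ 3 = of_real t" by (auto simp: triod_def)
    then have "cmod z ^ 3 = t" by (metis abs_of_nonneg norm_of_real norm_power)
    moreover from this have "cmod z \<le> 1"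
      using t power_le_one_iff[of "cmod z" 3] by simp
    moreover have "t \<noteq> 0" using t False by auto
    ultimately show "z = 0 \<or> sgn z ^ 3 = 1 \<and> cmod z \<le> 1" using z3 t by simp
  next
    assume "z = 0 \<or> sgn z ^ 3 = 1 \<and> cmod z \<le> 1"
    then show "z \<in> triod" using z3 False
      by (auto simp: triod_def power_le_one intro!: image_eqI[of _ _ "cmod z ^ 3"])
  qed
qed

lemma triod_cases:
  assumes "z \<in> triod" "z \<noteq> 0"
  shows "sgn z ^ 3 = 1" "cmod z \<le> 1" "z = cmod z *\<^sub>R sgn z"
  using assms triod_iff by (auto simp: sgn_div_norm)

lemma cube_root_norm:
  fixes w :: complex
  assumes "w ^ 3 = 1" shows "cmod w = 1"
proof -
  have "cmod w ^ 3 = 1 ^ 3" using assms by (simp flip: norm_power)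
  then show ?thesis by (rule power_eq_imp_eq_base) simp_all
qed

lemma sgn_scaleR_cube_root: "(w::complex) ^ 3 = 1 \<Longrightarrow> 0 < s \<Longrightarrow> sgn (s *\<^sub>R w) = w"
  using cube_root_norm[of w] by (simp add: sgn_div_norm)

lemma scaleR_in_triod: "w ^ 3 = 1 \<Longrightarrow> 0 \<le> s \<Longrightarrow> s \<le> 1 \<Longrightarrow> s *\<^sub>R w \<in> triod"
  by (cases "s = 0") (auto simp: triod_iff sgn_scaleR_cube_root cube_root_norm)

text \<open>Branches are encoded by their direction, the common value of \<open>sgn\<close>. On the triod,
  \<open>arm_coord w\<close> is the retraction to the branch in direction \<open>w\<close>: the other two branches make an
  obtuse angle with it and are sent to \<open>0\<close>.\<close>

definition arm_coord :: "complex \<Rightarrow> complex \<Rightarrow> real" where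
  "arm_coord w z = max 0 (Re (z * cnj w))"

lemma continuous_arm_coord [continuous_intros]:
  "continuous_on S g \<Longrightarrow> continuous_on S (\<lambda>x. arm_coord w (g x))"
  unfolding arm_coord_def by (intro continuous_intros)

lemma arm_coord_nonneg [simp]: "0 \<le> arm_coord w z"
  by (simp add: arm_coord_def)

lemma arm_coord_0 [simp]: "arm_coord w 0 = 0"
  by (simp add: arm_coord_def)

lemma arm_coord_scaleR: "w ^ 3 = 1 \<Longrightarrow> 0 \<le> s \<Longrightarrow> arm_coord w (s *\<^sub>R w) = s"
  using cube_root_norm[of w] complex_norm_square[of w] by (simp add: arm_coord_def scaleR_conv_of_real mult.assoc)

lemma arm_coord_sgn: "z \<in> triod \<Longrightarrow> arm_coord (sgn z) z = cmod z"
  using arm_coord_scaleR[of "sgn z" "cmod z"] triod_cases[of z] by (cases "z = 0") auto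

text \<open>For a cube root of unity other than 1 the factor \<open>v * v + v + 1\<close> of
  \<open>v ^ 3 - 1\<close> vanishes. It has no real root, so its imaginary part forces the real part
  -1/2.\<close>

lemma Re_cube_root_neg:
  assumes "v ^ 3 = 1" "v \<noteq> 1"
  shows "Re v < 0"
proof -
  have "(v - 1) * (v * v + v + 1) = 0"
    using assms(1) by (simp add: algebra_simps power3_eq_cube)
  then have v: "v * v + v + 1 = 0" using assms(2) by simp
  then have re: "Re v * Re v - Im v * Im v + Re v + 1 = 0" and im: "Im v * (2 * Re v + 1) = 0"
    by (auto simp: complex_eq_iff algebra_simps)
  have "Im v \<noteq> 0"
  proof
    assume "Im v = 0"
    then have "(Re v + 1 / 2) ^ 2 + 3 / 4 = 0"
      using re by (simp add: power2_eq_square algebra_simps)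
    then show False using zero_le_power2[of "Re v + 1 / 2"] by linarith
  qed
  then show ?thesis using im by simp
qed

text \<open>The quotient \<open>sgn z * cnj w\<close> of the two directions is a cube root of unity
  other than 1, so the real part truncated in \<open>arm_coord\<close> is negative.\<close>

lemma arm_coord_other:
  assumes z: "z \<in> triod" and w: "w ^ 3 = 1" and ne: "sgn z \<noteq> w"
  shows "arm_coord w z = 0"
proof (cases "z = 0")
  case False
  have "w * cnj w = 1" using cube_root_norm[OF w] complex_norm_square[of w] by simp
  then have "sgn z * cnj w * w = sgn z" by (simp add: mult.assoc mult.commute[of "cnj w"])
  then have "sgn z * cnj w \<noteq> 1" using ne by (metis mult_1)
  moreover have "(sgn z * cnj w) ^ 3 = 1"
    using triod_cases(1)[OF z False] w by (simp add: power_mult_distrib flip: complex_cnj_power)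
  ultimately have "Re (sgn z * cnj w) < 0" using Re_cube_root_neg by blast
  moreover have "z * cnj w = cmod z *\<^sub>R (sgn z * cnj w)"
    using triod_cases(3)[OF z False] by (metis mult_scaleR_left)
  ultimately show ?thesis
    by (simp add: arm_coord_def mult_nonneg_nonpos)
qed simp

lemma arm_coord_pos:
  assumes "z \<in> triod" "w ^ 3 = 1" "0 < arm_coord w z"
  shows "sgn z = w" "cmod z = arm_coord w z" "z = arm_coord w z *\<^sub>R w" "z \<noteq> 0"
proof -
  show s: "sgn z = w" using arm_coord_other assms by fastforce
  show c: "cmod z = arm_coord w z" using arm_coord_sgn[OF assms(1)] s by simp
  show z: "z \<noteq> 0" using c assms(3) by auto
  show "z = arm_coord w z *\<^sub>R w" using triod_cases(3)[OF assms(1) z] s c by simp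
qed

definition arm :: "complex \<Rightarrow> complex set" where
  "arm w = {z \<in> triod - {0}. sgn z = w}"

lemma arm_eq_image: "w ^ 3 = 1 \<Longrightarrow> arm w = (\<lambda>s. s *\<^sub>R w) ` {0<..1}"
proof (intro equalityI subsetI)
  fix z assume w: "w ^ 3 = 1" and "z \<in> arm w"
  then have "z = cmod z *\<^sub>R w" "cmod z \<in> {0<..1}"
    using triod_cases[of z] by (auto simp: arm_def)
  then show "z \<in> (\<lambda>s. s *\<^sub>R w) ` {0<..1}" by blast
next
  fix z assume w: "w ^ 3 = 1" and "z \<in> (\<lambda>s. s *\<^sub>R w) ` {0<..1}"
  then show "z \<in> arm w"
    using scaleR_in_triod[OF w] sgn_scaleR_cube_root[OF w] by (auto simp: arm_def)
qed

text \<open>On the triod without 0, \<open>sgn\<close> is continuous with finitely many values,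
  hence constant on connected subsets. So the arms are the maximal connected subsets.\<close>

lemma branches_eq: "branches = arm ` {w. w ^ 3 = 1}"
proof -
  have const: "sgn z = sgn y" if "connected D" "D \<subseteq> triod - {0}" "z \<in> D" "y \<in> D" for D z y
  proof -
    have "sgn ` D \<subseteq> {w. w ^ 3 = 1}" using that(2) triod_cases(1) by blast
    then have "finite (sgn ` D)" using finite_roots_unity[of 3, where 'a = complex] finite_subset by auto
    moreover have "continuous_on D sgn"
      using that(2) by (intro continuous_on_sgn continuous_on_id) auto
    ultimately have "sgn constant_on D"
      using continuous_finite_range_constant that(1) by blast
    then show ?thesis using that by (auto simp: constant_on_def)
  qed
  have arm: "arm w \<in> branches" if w: "w ^ 3 = 1" for w
    unfolding branches_def in_components_maximal
  proof (intro conjI allI impI)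
    show "arm w \<noteq> {}" by (simp add: arm_eq_image w)
    show sub: "arm w \<subseteq> triod - {0}" by (auto simp: arm_def)
    show "connected (arm w)" unfolding arm_eq_image[OF w]
      by (intro connected_continuous_image continuous_intros) simp
    fix D assume D: "D \<noteq> {} \<and> arm w \<subseteq> D \<and> D \<subseteq> triod - {0} \<and> connected D"
    obtain z where z: "z \<in> arm w" using \<open>arm w \<noteq> {}\<close> by blast
    have "sgn y = w" if "y \<in> D" for y
      using const[of D z y] D z that by (auto simp: arm_def)
    then show "D = arm w" using D by (auto simp: arm_def)
  qed
  show ?thesis
  proof
    show "arm ` {w. w ^ 3 = 1} \<subseteq> branches" using arm by auto
    show "branches \<subseteq> arm ` {w. w ^ 3 = 1}"
    proof
      fix B assume B: "B \<in> branches"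
      then have "B \<noteq> {}" unfolding branches_def using in_components_nonempty by blast
      then obtain z where z: "z \<in> B" by blast
      then have z': "z \<in> triod" "z \<noteq> 0" using branches_Union B by blast+
      then have "z \<in> arm (sgn z)" by (auto simp: arm_def)
      then have "B = arm (sgn z)"
        using branches_disjoint[OF B arm[OF triod_cases(1)[OF z']] z] by blast
      then show "B \<in> arm ` {w. w ^ 3 = 1}" using triod_cases(1)[OF z'] by blast
    qed
  qed
qed

lemma mem_branch_iff:
  assumes "B \<in> branches" "x \<in> B"
  shows "y \<in> B \<longleftrightarrow> y \<in> triod - {0} \<and> sgn y = sgn x"
  using assms by (auto simp: branches_eq arm_def)

lemma arm_in_branches: "z \<in> triod - {0} \<Longrightarrow> arm (sgn z) \<in> branches \<and> z \<in> arm (sgn z)"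
  using triod_cases(1) by (auto simp: branches_eq arm_def)

section \<open>Numbered branches and the branch distance\<close>

lemma branch_numbering_ex:
  assumes "branch_numbering b" "z \<in> triod - {0}"
  shows "\<exists>i<3. z \<in> b i"
  using assms arm_in_branches[OF assms(2)]
  by (metis bij_betw_imp_surj_on branch_numbering_def imageE lessThan_iff)

lemma branch_numbering_in: "branch_numbering b \<Longrightarrow> i < 3 \<Longrightarrow> b i \<in> branches"
  by (auto simp: branch_numbering_def bij_betw_def)

lemma branch_numbering_unique:
  assumes "branch_numbering b" "i < 3" "j < 3" "z \<in> b i" "z \<in> b j"
  shows "i = j"
proof -
  have "b i = b j" using branches_disjoint assms branch_numbering_in by metis
  then show ?thesis using assms by (auto simp: branch_numbering_def bij_betw_def inj_on_def)
qed

lemma less_3_cases: "(i::nat) < 3 \<longleftrightarrow> i = 0 \<or> i = 1 \<or> i = 2"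
  by auto

lemma branch_dist_eq:
  assumes b: "branch_numbering b" and i: "i < 3" and k: "k < 3"
    and u: "u \<in> b i" and v: "v \<in> b ((i + k) mod 3)"
  shows "branch_dist b u v = real k / 3"
proof -
  have "(THE k. k < 3 \<and> (\<exists>i<3. u \<in> b i \<and> v \<in> b ((i + k) mod 3))) = k"
  proof (rule the_equality)
    show "k < 3 \<and> (\<exists>i<3. u \<in> b i \<and> v \<in> b ((i + k) mod 3))" using assms by blast
    fix l assume "l < 3 \<and> (\<exists>i<3. u \<in> b i \<and> v \<in> b ((i + l) mod 3))"
    then obtain j where j: "l < 3" "j < 3" "u \<in> b j" "v \<in> b ((j + l) mod 3)" by blast
    then have "j = i" using branch_numbering_unique[OF b _ i _ u] by blast
    then have "(i + l) mod 3 = (i + k) mod 3"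
      using branch_numbering_unique[OF b _ _ j(4) v] by simp
    then show "l = k" using k j(1) i unfolding less_3_cases by (elim disjE) simp_all
  qed
  then show ?thesis by (simp add: branch_dist_def)
qed

lemma branch_dist_ex:
  assumes b: "branch_numbering b" and u: "u \<in> triod - {0}" and v: "v \<in> triod - {0}"
  obtains i k where "i < 3" "k < 3" "u \<in> b i" "v \<in> b ((i + k) mod 3)" "branch_dist b u v = real k / 3"
proof -
  obtain i j where ij: "i < 3" "j < 3" "u \<in> b i" "v \<in> b j"
    using branch_numbering_ex[OF b] u v by metis
  \<comment> \<open>Adding \<open>3 - i\<close> keeps the subtraction of natural numbers
    exact.\<close>
  define k where "k = (j + (3 - i)) mod 3"
  have "(i + k) mod 3 = j" using ij(1,2) unfolding k_def less_3_cases by (elim disjE) simp_all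
  moreover have "k < 3" by (simp add: k_def)
  ultimately show ?thesis using that branch_dist_eq[OF b ij(1) _ ij(3)] ij by metis
qed

lemma branch_dist_sgn:
  assumes "branch_numbering b" "u \<in> triod - {0}" "v \<in> triod - {0}" "u' \<in> triod - {0}" "v' \<in> triod - {0}"
    "sgn u' = sgn u" "sgn v' = sgn v"
  shows "branch_dist b u' v' = branch_dist b u v"
  by (rule branch_dist_cong) (use assms mem_branch_iff in blast)+

subsection \<open>Equivalent cycles and order isomorphisms\<close>

text \<open>This serves to extend an order correspondence between cycle points on one branch to an
  increasing map of moduli. The nodes are added from left to right.\<close>

lemma strict_mono_interpolation:
  fixes A :: "real set"
  assumes "finite A" "\<And>a. a \<in> A \<Longrightarrow> 0 < a" "\<And>a. a \<in> A \<Longrightarrow> 0 < q a"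
    "\<And>a b. a \<in> A \<Longrightarrow> b \<in> A \<Longrightarrow> a < b \<Longrightarrow> q a < q b"
  shows "\<exists>H. strict_mono H \<and> continuous_on UNIV H \<and> H 0 = (0::real) \<and> (\<forall>a\<in>A. H a = q a)"
  using assms
proof (induction A rule: finite_linorder_max_induct)
  case empty
  show ?case by (intro exI[of _ "\<lambda>s. s"]) (auto simp: strict_mono_def)
next
  case (insert b A)
  then have "\<exists>H. strict_mono H \<and> continuous_on UNIV H \<and> H 0 = (0::real) \<and> (\<forall>a\<in>A. H a = q a)"
    by auto
  then obtain H where H: "strict_mono H" "continuous_on UNIV H" "H 0 = (0::real)"
    "\<And>a. a \<in> A \<Longrightarrow> H a = q a" by blast
  define M where "M = Max (insert 0 A)"
  have M: "M \<in> insert 0 A" unfolding M_def using insert(1) by (intro Max_in) auto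
  have le: "a \<le> M" if "a \<in> insert 0 A" for a unfolding M_def using insert(1) that by (intro Max_ge) auto
  have bM: "M < b" and qM: "H M < q b"
    using M insert.hyps insert.prems H(3,4) by auto
  define c where "c = (q b - H M) / (b - M)"
  have c: "0 < c" using bM qM by (simp add: c_def)
  \<comment> \<open>\<open>H\<close> is frozen at \<open>M\<close>, the last node so far, and
    continued with the slope \<open>c\<close> that gives \<open>q b\<close> at \<open>b\<close>.
    Left of \<open>M\<close> the first summand is strictly increasing, right of it the
    second.\<close>
  define K where "K s = H (min s M) + c * max 0 (s - M)" for s
  have mono: "x \<le> y \<Longrightarrow> H x \<le> H y" for x y using H(1) by (simp add: strict_mono_less_eq)
  have "strict_mono K"
  proof (rule strict_monoI)
    fix x y :: real assume xy: "x < y"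
    show "K x < K y"
    proof (cases "x < M")
      case True
      have "H (min x M) < H (min y M)" using H(1) xy True by (auto simp: strict_mono_less)
      moreover have "c * max 0 (x - M) \<le> c * max 0 (y - M)" using c xy by (intro mult_left_mono) auto
      ultimately show ?thesis unfolding K_def by simp
    next
      case False
      then have "c * max 0 (x - M) < c * max 0 (y - M)" using c xy by (intro mult_strict_left_mono) auto
      moreover have "H (min x M) \<le> H (min y M)" using xy by (intro mono) auto
      ultimately show ?thesis unfolding K_def by simp
    qed
  qed
  moreover have "continuous_on UNIV K"
    unfolding K_def by (intro continuous_intros continuous_on_compose2[OF H(2)]) auto
  moreover have "K 0 = 0" using le[of 0] H(3) by (simp add: K_def)
  moreover have "K a = q a" if "a \<in> insert b A" for a
  proof (cases "a = b")
    case True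
    then show ?thesis using bM by (simp add: K_def c_def)
  next
    case False
    then show ?thesis using that le[of a] H(4)[of a] by (simp add: K_def)
  qed
  ultimately show ?case by blast
qed

lemma not_in_one_branch:
  assumes "x \<in> P" "y \<in> P" "sgn x \<noteq> sgn y"
  shows "\<not> (\<exists>B\<in>branches. P \<subseteq> B)"
  using assms mem_branch_iff by blast

text \<open>The star of segments is connected. Conversely, a connected set containing
  \<open>P\<close> contains 0, as \<open>P\<close> meets two branches; retracting it to a branch
  shows that it contains the segment to each point of \<open>P\<close>.\<close>

lemma triod_hull_eq:
  assumes c: "(f, P) \<in> cycles" and xy: "x \<in> P" "y \<in> P" "sgn x \<noteq> sgn y"
  shows "triod_hull P = (\<Union>x\<in>P. closed_segment 0 x)"
proof
  have PT: "P \<subseteq> triod - {0}" using orbit_notin_fixed(1)[OF c] .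
  show "triod_hull P \<subseteq> (\<Union>x\<in>P. closed_segment 0 x)"
  proof -
    have "starlike (\<Union>x\<in>P. closed_segment 0 x)"
      unfolding starlike_def
    proof (intro bexI ballI)
      show "0 \<in> (\<Union>x\<in>P. closed_segment 0 x)" using xy by auto
      fix z assume "z \<in> (\<Union>x\<in>P. closed_segment 0 x)"
      then obtain x where x: "x \<in> P" "z \<in> closed_segment 0 x" by blast
      then have "closed_segment 0 z \<subseteq> closed_segment 0 x" by (simp add: subset_closed_segment)
      then show "closed_segment 0 z \<subseteq> (\<Union>x\<in>P. closed_segment 0 x)" using x by blast
    qed
    then have "connected (\<Union>x\<in>P. closed_segment 0 x)" by (rule starlike_imp_connected)
    moreover have "(\<Union>x\<in>P. closed_segment 0 x) \<subseteq> triod"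
    proof clarify
      fix z x assume x: "x \<in> P" "z \<in> closed_segment 0 x"
      then obtain u where u: "0 \<le> u" "u \<le> 1" "z = u *\<^sub>R x" by (auto simp: in_segment)
      have x': "x \<in> triod" "x \<noteq> 0" using x PT by auto
      have "z = (u * cmod x) *\<^sub>R sgn x" using u triod_cases(3)[OF x'] by (metis scaleR_scaleR)
      moreover have "u * cmod x \<le> 1" using u triod_cases(2)[OF x'] by (simp add: mult_le_one)
      ultimately show "z \<in> triod" using scaleR_in_triod[OF triod_cases(1)[OF x']] u by simp
    qed
    ultimately show ?thesis unfolding triod_hull_def by blast
  qed
  show "(\<Union>x\<in>P. closed_segment 0 x) \<subseteq> triod_hull P"
  proof clarify
    fix z x assume x: "x \<in> P" "z \<in> closed_segment 0 x"
    then obtain u where u: "0 \<le> u" "u \<le> 1" "z = u *\<^sub>R x" by (auto simp: in_segment)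
    have x': "x \<in> triod" "x \<noteq> 0" using x PT by auto
    note w = triod_cases(1)[OF x']
    have 0: "0 \<in> triod_hull P" using triod_hull_zero_iff[OF c] not_in_one_branch[OF xy] by blast
    show "z \<in> triod_hull P"
      unfolding triod_hull_def
    proof clarify
      fix C assume C: "C \<subseteq> triod" "connected C" "P \<subseteq> C"
      have 0: "0 \<in> C" using 0 C unfolding triod_hull_def by blast
      have zc: "z = (u * cmod x) *\<^sub>R sgn x" using u triod_cases(3)[OF x'] by (metis scaleR_scaleR)
      show "z \<in> C"
      proof (cases "u = 0")
        case True
        then show ?thesis using u 0 by simp
      next
        case False
        have "connected (arm_coord (sgn x) ` C)"
          using C(2) by (intro connected_continuous_image continuous_intros)
        moreover have "0 \<in> arm_coord (sgn x) ` C" using 0 by (metis arm_coord_0 imageI)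
        moreover have "cmod x \<in> arm_coord (sgn x) ` C"
          using x(1) C(3) arm_coord_sgn[OF x'(1)] by (metis imageI subsetD)
        moreover have "0 \<le> u * cmod x" "u * cmod x \<le> cmod x"
          using u by (auto simp: mult_left_le_one_le)
        ultimately have "u * cmod x \<in> arm_coord (sgn x) ` C"
          using connectedD_interval by blast
        then obtain y where y: "y \<in> C" "arm_coord (sgn x) y = u * cmod x" by auto
        then have "0 < arm_coord (sgn x) y" using False u x' by simp
        then have "y = z" using arm_coord_pos(3)[OF _ w] y zc C by (metis subsetD)
        then show ?thesis using y by simp
      qed
    qed
  qed
qed

lemma finite_cycle: "(f, P) \<in> cycles \<Longrightarrow> finite P"
  by (auto simp: cycles_def cyclic_on_def intro: finite_orbit)

text \<open>The main point is that \<open>h\<close> fixes 0. Then on each segment from 0 to a point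
  of \<open>P\<close> the modulus of \<open>h\<close> is continuous and injective and starts at 0,
  so it increases.\<close>

lemma cycle_order_iso:
  assumes e: "((f, P), (g, Q)) \<in> cycle_equiv"
    and xyP: "x \<in> P" "y \<in> P" "sgn x \<noteq> sgn y"
  obtains h where "h ` P = Q" "\<And>x. x \<in> P \<Longrightarrow> h (f x) = g (h x)" "\<And>x. x \<in> P \<Longrightarrow> sgn (h x) = sgn x"
    "\<And>x y. x \<in> P \<Longrightarrow> y \<in> P \<Longrightarrow> sgn x = sgn y \<Longrightarrow> cmod (h x) < cmod (h y) \<longleftrightarrow> cmod x < cmod y"
proof -
  from e obtain h k where cyc: "(f, P) \<in> cycles" "(g, Q) \<in> cycles"
    and hom: "homeomorphism (triod_hull P) (triod_hull Q) h k" and hP: "h ` P = Q"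
    and conj: "\<forall>x\<in>P. h (f x) = g (h x)"
    and br: "\<forall>B\<in>branches. h ` (triod_hull P \<inter> B) \<subseteq> B"
    by (auto simp: cycle_equiv_def)
  have PT: "P \<subseteq> triod - {0}" using orbit_notin_fixed(1)[OF cyc(1)] .
  note HT = triod_hull_subset[OF cyc(1)]
  have sgn_h: "sgn (h z) = sgn z" "h z \<in> triod - {0}" if "z \<in> triod_hull P" "z \<noteq> 0" for z
  proof -
    have z: "z \<in> triod - {0}" using that HT by auto
    note a = arm_in_branches[OF z]
    then have "h z \<in> arm (sgn z)" using br that by blast
    then show "sgn (h z) = sgn z" "h z \<in> triod - {0}"
      by (auto simp: arm_def)
  qed
  have cont: "continuous_on (triod_hull P) h" and inj: "inj_on h (triod_hull P)"
    using hom by (auto simp: homeomorphism_def intro: inj_on_inverseI)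
  have seg: "s *\<^sub>R sgn z \<in> triod_hull P" if z: "z \<in> P" and s: "0 \<le> s" "s \<le> cmod z" for s z
  proof -
    have "z \<noteq> 0" using z PT by auto
    then have "s *\<^sub>R sgn z = (s / cmod z) *\<^sub>R z" by (simp add: sgn_div_norm divide_inverse)
    moreover have "0 \<le> s / cmod z" "s / cmod z \<le> 1" using s by (auto simp: divide_le_eq_1)
    ultimately have "s *\<^sub>R sgn z \<in> closed_segment 0 z" by (auto simp: in_segment)
    then show ?thesis using z triod_hull_eq[OF cyc(1) xyP] by blast
  qed
  have cont_seg: "continuous_on {0..cmod z} (\<lambda>s. h (s *\<^sub>R sgn z))" if z: "z \<in> P" for z
    using seg[OF z] by (intro continuous_on_compose2[OF cont] continuous_intros) auto
  \<comment> \<open>For small \<open>s > 0\<close> the image of \<open>s *\<^sub>R sgn z\<close>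
    lies on the branch of \<open>z\<close>, where coordinate and modulus agree; the equality passes
    to the limit at 0.\<close>
  have lim0: "arm_coord (sgn z) (h 0) = cmod (h 0)" if z: "z \<in> P" for z
  proof (rule ccontr)
    assume ne: "arm_coord (sgn z) (h 0) \<noteq> cmod (h 0)"
    have z': "z \<in> triod" "z \<noteq> 0" using z PT by auto
    let ?d = "\<lambda>s. cmod (h (s *\<^sub>R sgn z)) - arm_coord (sgn z) (h (s *\<^sub>R sgn z))"
    have d0: "?d s = 0" if "s \<in> {0<..cmod z}" for s
    proof -
      have s: "s *\<^sub>R sgn z \<in> triod_hull P" "s *\<^sub>R sgn z \<noteq> 0" using that seg[OF z, of s] z' by (auto simp: sgn_zero_iff)
      have "sgn (s *\<^sub>R sgn z) = sgn z" using that z' triod_cases(1) sgn_scaleR_cube_root by simp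
      then show ?thesis using sgn_h[OF s] arm_coord_sgn by (metis DiffD1 diff_self)
    qed
    have "continuous_on {0..cmod z} ?d" by (intro continuous_intros cont_seg z)
    then have "(?d \<longlongrightarrow> ?d 0) (at 0 within {0..cmod z})"
      unfolding continuous_on_def by (rule bspec) simp
    then have "(?d \<longlongrightarrow> ?d 0) (at_right 0)"
      using z' at_within_Icc_at_right[of 0 "cmod z"] by simp
    moreover have "eventually (\<lambda>s. ?d s = 0) (at_right 0)"
      using z' d0 by (intro eventually_at_rightI[of 0 "cmod z"]) auto
    ultimately have "((\<lambda>s. 0) \<longlongrightarrow> ?d 0) (at_right (0::real))"
      by (rule Lim_transform_eventually)
    then have "?d 0 = 0" by (simp add: tendsto_const_iff)
    then show False using ne by simp
  qed
  \<comment> \<open>By \<open>lim0\<close>, a nonzero \<open>h 0\<close> would lie on the branch of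
    every point of \<open>P\<close>, but \<open>P\<close> meets two branches.\<close>
  have h0: "h 0 = 0"
  proof (rule ccontr)
    assume ne: "h 0 \<noteq> 0"
    have "0 \<in> triod_hull P" using seg[OF xyP(1), of 0] by simp
    then have T: "h 0 \<in> triod"
      using hom triod_hull_subset(2)[OF cyc(2)] by (auto simp: homeomorphism_def)
    have "sgn (h 0) = sgn z" if "z \<in> P" for z
      using arm_coord_pos(1)[OF T, of "sgn z"] lim0[OF that] ne triod_cases(1) that PT
      by (metis DiffD1 DiffD2 singletonI subsetD zero_less_norm_iff)
    then show False using xyP by metis
  qed
  have less: "cmod (h x) < cmod (h y)" if xy: "x \<in> P" "y \<in> P" "sgn x = sgn y" "cmod x < cmod y" for x y
  proof -
    have x': "x \<in> triod" "x \<noteq> 0" and y': "y \<in> triod" "y \<noteq> 0" using xy PT by auto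
    let ?F = "\<lambda>s. cmod (h (s *\<^sub>R sgn y))"
    have "inj_on ?F {0..cmod y}"
    proof (rule inj_onI)
      fix s t assume s: "s \<in> {0..cmod y}" and t: "t \<in> {0..cmod y}" and eq: "?F s = ?F t"
      have S: "sgn (h (r *\<^sub>R sgn y)) = sgn y" if "r \<in> {0..cmod y}" "0 < r" for r
        using sgn_h(1)[OF seg[OF xy(2), of r]] that y' sgn_scaleR_cube_root triod_cases(1) by (auto simp: sgn_zero_iff)
      have "sgn (h (s *\<^sub>R sgn y)) = sgn (h (t *\<^sub>R sgn y))"
      proof (cases "s = 0 \<or> t = 0")
        case True
        then have "h (s *\<^sub>R sgn y) = 0 \<and> h (t *\<^sub>R sgn y) = 0" using eq h0 by auto
        then show ?thesis by simp
      next
        case False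
        then show ?thesis using S s t by simp
      qed
      then have "h (s *\<^sub>R sgn y) = h (t *\<^sub>R sgn y)"
        using eq by (rule sgn_norm_eqI)
      then have "s *\<^sub>R sgn y = t *\<^sub>R sgn y" using inj_onD[OF inj _ seg[OF xy(2)] seg[OF xy(2)]] s t by simp
      then show "s = t" using y' by (simp add: sgn_zero_iff)
    qed
    moreover have "continuous_on {0..cmod y} ?F" by (intro continuous_intros cont_seg xy)
    ultimately have "(?F 0 < ?F (cmod x) \<and> ?F (cmod x) < ?F (cmod y)) \<or> (?F (cmod y) < ?F (cmod x) \<and> ?F (cmod x) < ?F 0)"
      using x' xy by (intro continuous_inj_imp_mono) auto
    then have "?F (cmod x) < ?F (cmod y)" using h0 by (simp add: leD)
    then show ?thesis using triod_cases(3)[OF x'] triod_cases(3)[OF y'] xy(3) by simp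
  qed
  show ?thesis
  proof
    show "h ` P = Q" by fact
    show "h (f x) = g (h x)" if "x \<in> P" for x using conj that by blast
    show "sgn (h x) = sgn x" if "x \<in> P" for x using sgn_h(1)[of x] that PT HT by auto
    fix x y assume xy: "x \<in> P" "y \<in> P" "sgn x = sgn y"
    have "x = y" if "cmod x = cmod y"
    proof -
      have "x \<in> triod" "x \<noteq> 0" "y \<in> triod" "y \<noteq> 0" using xy PT by auto
      then show ?thesis using triod_cases(3) that xy(3) by metis
    qed
    then show "cmod (h x) < cmod (h y) \<longleftrightarrow> cmod x < cmod y"
      using less[OF xy] less[OF xy(2,1) xy(3)[symmetric]]
      by (metis linorder_neqE_linordered_idom not_less_iff_gr_or_eq)
  qed
qed

text \<open>This is the converse of \<open>cycle_order_iso\<close>. The cycles are enumerated along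
  their orbits, so that equal indices correspond; increasing interpolations on the three branches
  are glued at 0.\<close>

lemma cycle_equivI:
  assumes cyc: "(f, range u) \<in> cycles" "(g, range v) \<in> cycles"
    and step: "\<And>i. f (u i) = u (Suc i)" "\<And>i. g (v i) = v (Suc i)"
    and sgn: "\<And>i. sgn (v i) = sgn (u i)"
    and order: "\<And>i j. sgn (u i) = sgn (u j) \<Longrightarrow> cmod (v i) < cmod (v j) \<longleftrightarrow> cmod (u i) < cmod (u j)"
    and multi: "sgn (u i) \<noteq> sgn (u j)"
  shows "((f, range u), (g, range v)) \<in> cycle_equiv"
proof -
  have uT: "u i \<in> triod" "u i \<noteq> 0" and vT: "v i \<in> triod" "v i \<noteq> 0" for i
    using orbit_notin_fixed(1)[OF cyc(1)] orbit_notin_fixed(1)[OF cyc(2)] by auto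
  note hull = triod_hull_eq[OF cyc(1) rangeI rangeI multi]
    triod_hull_eq[OF cyc(2) rangeI rangeI, of i j, unfolded sgn, OF multi]
  have "\<exists>H. strict_mono H \<and> continuous_on UNIV H \<and> H 0 = (0::real) \<and> (\<forall>i. sgn (u i) = w \<longrightarrow> H (cmod (u i)) = cmod (v i))"
    for w
  proof -
    define A where "A = cmod ` {x \<in> range u. sgn x = w}"
    \<comment> \<open>The enumeration may repeat points. By \<open>order\<close>, used in both
      directions, the value does not depend on the chosen index.\<close>
    define q where "q a = cmod (v (SOME i. sgn (u i) = w \<and> cmod (u i) = a))" for a
    have q: "q (cmod (u i)) = cmod (v i)" if "sgn (u i) = w" for i
    proof -
      define j where "j = (SOME j. sgn (u j) = w \<and> cmod (u j) = cmod (u i))"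
      have "sgn (u j) = w \<and> cmod (u j) = cmod (u i)"
        unfolding j_def by (rule someI[of _ i]) (use that in simp)
      then have "cmod (v j) = cmod (v i)"
        using order[of i j] order[of j i] that by simp
      then show ?thesis unfolding q_def j_def .
    qed
    have "\<exists>H. strict_mono H \<and> continuous_on UNIV H \<and> H 0 = (0::real) \<and> (\<forall>a\<in>A. H a = q a)"
    proof (rule strict_mono_interpolation)
      show "finite A" unfolding A_def using finite_cycle[OF cyc(1)] by auto
    qed (use uT vT order in \<open>auto simp: A_def q\<close>)
    then obtain H where "strict_mono H" "continuous_on UNIV H" "H 0 = (0::real)" "\<forall>a\<in>A. H a = q a" by blast
    moreover from this have "H (cmod (u i)) = cmod (v i)" if "sgn (u i) = w" for i
      using q[OF that] that by (auto simp: A_def)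
    ultimately show ?thesis by blast
  qed
  then obtain H where H: "\<And>w. strict_mono (H w)" "\<And>w. continuous_on UNIV (H w)" "\<And>w. H w 0 = (0::real)"
    "\<And>i. H (sgn (u i)) (cmod (u i)) = cmod (v i)" by metis
  define R where "R = {w::complex. w ^ 3 = 1}"
  have finR: "finite R" unfolding R_def using finite_roots_unity[of 3, where 'a = complex] by simp
  \<comment> \<open>At a point of the triod at most the summand of its own branch is nonzero. The
    sum over all directions makes continuity at 0 immediate.\<close>
  define h where "h z = (\<Sum>w\<in>R. H w (arm_coord w z) *\<^sub>R w)" for z
  have h_eq: "h z = H (sgn z) (cmod z) *\<^sub>R sgn z" if z: "z \<in> triod" for z
  proof (cases "z = 0")
    case True
    then show ?thesis by (simp add: h_def H)
  next
    case False
    have "h z = (\<Sum>w\<in>R. if w = sgn z then H (sgn z) (cmod z) *\<^sub>R sgn z else 0)"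
      unfolding h_def using arm_coord_other[OF z] arm_coord_sgn[OF z] H(3)
      by (intro sum.cong) (auto simp: R_def)
    also have "\<dots> = H (sgn z) (cmod z) *\<^sub>R sgn z"
      using finR triod_cases(1)[OF z False] by (simp add: R_def)
    finally show ?thesis .
  qed
  have Hpos: "0 < s \<Longrightarrow> 0 < H w s" for w s using strict_monoD[OF H(1), of 0 s] H(3) by simp
  have hz: "sgn (h z) = sgn z" "cmod (h z) = H (sgn z) (cmod z)" if z: "z \<in> triod" for z
  proof -
    show "sgn (h z) = sgn z"
      using h_eq[OF z] sgn_scaleR_cube_root[OF triod_cases(1)[OF z]] Hpos[of "cmod z" "sgn z"] H(3)
      by (cases "z = 0") auto
    show "cmod (h z) = H (sgn z) (cmod z)"
      using h_eq[OF z] Hpos[of "cmod z" "sgn z"] H(3) cube_root_norm[OF triod_cases(1)[OF z]]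
      by (cases "z = 0") auto
  qed
  have hu: "h (u i) = v i" for i
    using h_eq[OF uT(1)[of i]] H(4)[of i] sgn[of i] triod_cases(3)[OF vT[of i]] by simp
  have HT: "triod_hull (range u) \<subseteq> triod" using triod_hull_subset(2)[OF cyc(1)] .
  have "\<exists>k. homeomorphism (triod_hull (range u)) (triod_hull (range v)) h k"
  proof (rule homeomorphism_compact)
    show "compact (triod_hull (range u))"
      unfolding hull using finite_cycle[OF cyc(1)] by (intro compact_UN) auto
    show "continuous_on (triod_hull (range u)) h"
      unfolding h_def by (intro continuous_intros continuous_on_compose2[OF H(2)]) auto
    show "inj_on h (triod_hull (range u))"
    proof (rule inj_onI)
      fix x y assume "x \<in> triod_hull (range u)" "y \<in> triod_hull (range u)" and e: "h x = h y"
      then have T: "x \<in> triod" "y \<in> triod" using HT by auto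
      then have s: "sgn x = sgn y" using hz e by metis
      then have "H (sgn x) (cmod x) = H (sgn x) (cmod y)" using hz(2) T e by metis
      then have "cmod x = cmod y" using strict_mono_eq[OF H(1)] by blast
      then show "x = y" by (rule sgn_norm_eqI[OF s])
    qed
    have "h ` closed_segment 0 (u i) = closed_segment 0 (v i)" for i
    proof -
      define w where "w = sgn (u i)"
      have w: "w ^ 3 = 1" using triod_cases(1)[OF uT] by (simp add: w_def)
      have seg: "closed_segment 0 z = (\<lambda>s. s *\<^sub>R w) ` {0..cmod z}" if "sgn z = w" "z \<noteq> 0" for z
      proof -
        have "closed_segment 0 z = (\<lambda>s. s *\<^sub>R z) ` {0..1}" by (simp add: closed_segment_image_interval)
        also have "\<dots> = (\<lambda>s. s *\<^sub>R w) ` (\<lambda>s. s * cmod z) ` {0..1}"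
          using that by (auto simp: image_image sgn_div_norm field_simps)
        also have "(\<lambda>s. s * cmod z) ` {0..1} = {0..cmod z}"
          using that image_mult_atLeastAtMost[of "cmod z" 0 1] by (simp add: mult.commute)
        finally show ?thesis .
      qed
      have "H w ` {0..cmod (u i)} = {0..cmod (v i)}"
      proof (intro equalityI subsetI)
        fix y assume "y \<in> {0..cmod (v i)}"
        then have "\<exists>x. 0 \<le> x \<and> x \<le> cmod (u i) \<and> H w x = y"
          using H(3,4) by (intro IVT' continuous_on_subset[OF H(2)]) (auto simp: w_def)
        then show "y \<in> H w ` {0..cmod (u i)}" by auto
      next
        fix y assume "y \<in> H w ` {0..cmod (u i)}"
        then obtain x where "0 \<le> x" "x \<le> cmod (u i)" "y = H w x" by auto
        then show "y \<in> {0..cmod (v i)}"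
          using strict_mono_less_eq[OF H(1)[of w]] H(3)[of w] H(4)[of i] by (metis atLeastAtMost_iff w_def)
      qed
      moreover have "h ` (\<lambda>s. s *\<^sub>R w) ` {0..cmod (u i)} = (\<lambda>s. s *\<^sub>R w) ` H w ` {0..cmod (u i)}"
      proof -
        have "h (s *\<^sub>R w) = H w s *\<^sub>R w" if s: "s \<in> {0..cmod (u i)}" for s
        proof (cases "s = 0")
          case False
          have "s *\<^sub>R w \<in> triod" using s triod_cases(2)[OF uT[of i]] by (intro scaleR_in_triod w) auto
          then show ?thesis using h_eq[of "s *\<^sub>R w"] sgn_scaleR_cube_root[OF w, of s] s False cube_root_norm[OF w]
            by simp
        qed (simp add: h_def H(3))
        then show ?thesis by (auto simp: image_image)
      qed
      ultimately show ?thesis using seg[of "u i"] seg[of "v i"] uT[of i] vT[of i] sgn[of i] by (simp add: w_def)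
    qed
    then show "h ` triod_hull (range u) = triod_hull (range v)"
      unfolding hull by (simp add: image_UN)
  qed
  then obtain k where k: "homeomorphism (triod_hull (range u)) (triod_hull (range v)) h k" by blast
  have "h ` range u = range v" by (auto simp: hu image_image)
  moreover have "\<forall>x\<in>range u. h (f x) = g (h x)" using step hu by auto
  moreover have "h ` (triod_hull (range u) \<inter> B) \<subseteq> B" if B: "B \<in> branches" for B
  proof clarify
    fix x assume x: "x \<in> triod_hull (range u)" "x \<in> B"
    then have "x \<in> triod - {0}" using mem_branch_iff[OF B x(2)] by blast
    moreover have "h x \<in> triod" using k x(1) triod_hull_subset(2)[OF cyc(2)] by (auto simp: homeomorphism_def)
    ultimately show "h x \<in> B" using mem_branch_iff[OF B x(2)] hz(1)[of x] by (metis DiffD1 DiffD2 DiffI singletonD singletonI sgn_zero_iff)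
  qed
  ultimately show ?thesis unfolding cycle_equiv_def using cyc k by blast
qed

subsection \<open>Least paths and their shadows\<close>

definition below :: "complex \<Rightarrow> complex \<Rightarrow> bool" where
  "below x y \<longleftrightarrow> sgn x = sgn y \<and> cmod x \<le> cmod y"

lemma below_refl [simp]: "below x x"
  by (simp add: below_def)

lemma below_trans [trans]: "below x y \<Longrightarrow> below y z \<Longrightarrow> below x z"
  by (auto simp: below_def)

lemma below_antisym: "below x y \<Longrightarrow> below y x \<Longrightarrow> x = y"
  by (auto simp: below_def intro: sgn_norm_eqI)

lemma below_less: "below x y \<Longrightarrow> x \<noteq> y \<Longrightarrow> cmod x < cmod y"
  using sgn_norm_eqI[of x y] by (fastforce simp: below_def)

text \<open>The supremum runs over a sublevel set instead of the preimages of \<open>t\<close>. If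
  \<open>below t (f d)\<close>, it is the last preimage on the segment from 0 to \<open>d\<close>,
  and the sublevel form also bounds all points whose images fall short of \<open>t\<close>.\<close>

definition last_pre :: "(complex \<Rightarrow> complex) \<Rightarrow> complex \<Rightarrow> complex \<Rightarrow> complex" where
  "last_pre f d t =
     Sup {s \<in> {0..cmod d}. arm_coord (sgn t) (f (s *\<^sub>R sgn d)) \<le> cmod t} *\<^sub>R sgn d"

lemma triod_mapsD:
  assumes "f \<in> triod_maps"
  shows "continuous_on triod f" "x \<in> triod \<Longrightarrow> f x \<in> triod" "f 0 = 0"
    "x \<in> triod \<Longrightarrow> f x = x \<Longrightarrow> x = 0"
  using assms by (auto simp: triod_maps_def)

lemma segment_in_triod:
  assumes "d \<in> triod - {0}" "0 \<le> s" "s \<le> cmod d"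
  shows "s *\<^sub>R sgn d \<in> triod"
  using assms triod_cases[of d] by (intro scaleR_in_triod) auto

lemma continuous_on_segment:
  assumes "f \<in> triod_maps" "d \<in> triod - {0}"
  shows "continuous_on {0..cmod d} (\<lambda>s. f (s *\<^sub>R sgn d))"
  using segment_in_triod[OF assms(2)]
  by (intro continuous_on_compose2[OF triod_mapsD(1)[OF assms(1)]] continuous_intros) auto

text \<open>The coordinate \<open>F\<close> of the image is 0 at 0 and at least
  \<open>cmod t\<close> at the end. If it were smaller than \<open>cmod t\<close> at the supremum,
  that value would be attained further out. If \<open>f e\<close> does not cover \<open>t\<close>,
  then \<open>F\<close> is smaller than \<open>cmod t\<close> at \<open>e\<close>, so
  \<open>e\<close> comes before the supremum.\<close>

lemma
  assumes f: "f \<in> triod_maps" and d: "d \<in> triod - {0}" and t: "t \<in> triod - {0}" and td: "below t (f d)"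
  shows last_pre_in: "last_pre f d t \<in> triod - {0}" "below (last_pre f d t) d"
    and last_pre_image: "f (last_pre f d t) = t"
    and last_pre_last: "e \<in> triod \<Longrightarrow> below e d \<Longrightarrow> \<not> below t (f e) \<Longrightarrow> cmod e < cmod (last_pre f d t)"
proof -
  define F where "F s = arm_coord (sgn t) (f (s *\<^sub>R sgn d))" for s
  define S where "S = {s \<in> {0..cmod d}. F s \<le> cmod t}"
  define \<sigma> where "\<sigma> = Sup S"
  have w: "sgn t ^ 3 = 1" and v: "sgn d ^ 3 = 1" using triod_cases(1) t d by auto
  have contF: "continuous_on {0..cmod d} F"
    unfolding F_def by (intro continuous_intros continuous_on_segment f d)
  have F0: "F 0 = 0" using triod_mapsD(3)[OF f] by (simp add: F_def)
  have fd: "f d \<in> triod" using triod_mapsD(2)[OF f] d by auto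
  have Fd: "cmod t \<le> F (cmod d)"
    using td arm_coord_sgn[OF fd] triod_cases(3)[of d] d by (simp add: F_def below_def)
  have "closed S" unfolding S_def
    using continuous_on_closed_Collect_le[OF contF continuous_on_const[of _ "cmod t"]] by simp
  moreover have S0: "0 \<in> S" by (simp add: S_def F0)
  moreover have bdd: "bdd_above S" unfolding S_def by (intro bdd_aboveI[of _ "cmod d"]) auto
  ultimately have "\<sigma> \<in> S" unfolding \<sigma>_def by (intro closed_contains_Sup) auto
  then have \<sigma>: "0 \<le> \<sigma>" "\<sigma> \<le> cmod d" "F \<sigma> \<le> cmod t" by (auto simp: S_def)
  have \<sigma>_max: "s \<le> \<sigma>" if "s \<in> S" for s
    unfolding \<sigma>_def using bdd that by (intro cSup_upper)
  have F\<sigma>: "F \<sigma> = cmod t"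
  proof (rule ccontr)
    assume "F \<sigma> \<noteq> cmod t"
    moreover have "\<exists>s\<ge>\<sigma>. s \<le> cmod d \<and> F s = cmod t"
      using \<sigma> Fd by (intro IVT' continuous_on_subset[OF contF]) auto
    then obtain s where "\<sigma> \<le> s" "s \<le> cmod d" "F s = cmod t" by auto
    moreover from this have "s \<in> S" using \<sigma>(1) by (auto simp: S_def)
    ultimately show False using \<sigma>_max[of s] by auto
  qed
  have \<sigma>0: "\<sigma> \<noteq> 0" using F\<sigma> F0 t by auto
  have p: "last_pre f d t = \<sigma> *\<^sub>R sgn d" by (simp add: last_pre_def \<sigma>_def S_def F_def)
  have pc: "cmod (last_pre f d t) = \<sigma>" "sgn (last_pre f d t) = sgn d"
    using p \<sigma>(1) \<sigma>0 cube_root_norm[OF v] sgn_scaleR_cube_root[OF v, of \<sigma>] by auto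
  show pT: "last_pre f d t \<in> triod - {0}" "below (last_pre f d t) d"
    using pc \<sigma> \<sigma>0 segment_in_triod[OF d \<sigma>(1,2)] p by (auto simp: below_def)
  have "f (last_pre f d t) \<in> triod" using triod_mapsD(2)[OF f] pT by auto
  then have "f (last_pre f d t) = F \<sigma> *\<^sub>R sgn t"
    using arm_coord_pos(3)[OF _ w, of "f (last_pre f d t)"] F\<sigma> t p by (auto simp: F_def)
  then show pt: "f (last_pre f d t) = t" using F\<sigma> triod_cases(3)[of t] t by simp
  assume e: "e \<in> triod" "below e d" "\<not> below t (f e)"
  have es: "cmod e *\<^sub>R sgn d = e" using e(1,2) triod_cases(3)[of e] by (cases "e = 0") (auto simp: below_def)
  have "F (cmod e) < cmod t"
  proof (rule ccontr)
    assume "\<not> F (cmod e) < cmod t"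
    then have le: "cmod t \<le> arm_coord (sgn t) (f e)" by (simp add: F_def es)
    then have "0 < arm_coord (sgn t) (f e)" using t by auto (metis norm_le_zero_iff not_le le_less_trans)
    then show False
      using arm_coord_pos[OF triod_mapsD(2)[OF f e(1)] w] e(3) le by (simp add: below_def)
  qed
  then have "cmod e \<in> S" "cmod e \<noteq> \<sigma>" using e(2) F\<sigma> by (auto simp: S_def below_def)
  then show "cmod e < cmod (last_pre f d t)" using \<sigma>_max pc by fastforce
qed

lemma last_pre_less:
  assumes f: "f \<in> triod_maps" and d: "d \<in> triod - {0}" and t: "t \<in> triod - {0}" "t' \<in> triod - {0}"
    and td: "below t (f d)" "below t' (f d)" and less: "cmod t < cmod t'"
  shows "cmod (last_pre f d t) < cmod (last_pre f d t')"
  using last_pre_last[OF f d t(2) td(2), of "last_pre f d t"] last_pre_in[OF f d t(1) td(1)]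
    last_pre_image[OF f d t(1) td(1)] less
  by (auto simp: below_def)

section \<open>Paths of cycle points\<close>

definition point_path :: "(complex \<Rightarrow> complex) \<Rightarrow> complex set \<Rightarrow> (nat \<Rightarrow> complex) \<Rightarrow> (nat \<Rightarrow> complex) \<Rightarrow> bool" where
  "point_path f P \<beta> v \<longleftrightarrow> (\<forall>i. v i \<in> P \<and> sgn (v i) = \<beta> i \<and> below (v (Suc i)) (f (v i)))"

text \<open>Here \<open>\<beta>\<close> is the sequence of directions of the branches visited by the path. As all tails of
  \<open>\<beta>\<close> are considered, each \<open>d i\<close> is determined by the tail of \<open>\<beta>\<close> that starts at \<open>i\<close>.\<close>

definition least_path :: "(complex \<Rightarrow> complex) \<Rightarrow> complex set \<Rightarrow> (nat \<Rightarrow> complex) \<Rightarrow> (nat \<Rightarrow> complex) \<Rightarrow> bool" where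
  "least_path f P \<beta> d \<longleftrightarrow> point_path f P \<beta> d \<and>
     (\<forall>i v. point_path f P (\<lambda>k. \<beta> (i + k)) v \<longrightarrow> below (d i) (v 0))"

lemma point_path_shift: "point_path f P \<beta> v \<Longrightarrow> point_path f P (\<lambda>k. \<beta> (i + k)) (\<lambda>k. v (i + k))"
  unfolding point_path_def by (metis add_Suc_right)

text \<open>A path with least starting point is chosen for each tail separately. These starting
  points form a path: dropping the first point of the choice for one tail gives a competitor for the
  next tail.\<close>

lemma least_path_exists:
  assumes fin: "finite P" and x: "point_path f P \<beta> x"
  shows "\<exists>d. least_path f P \<beta> d"
proof -
  have "\<exists>v. point_path f P (\<lambda>k. \<beta> (i + k)) v \<and>
      (\<forall>v'. point_path f P (\<lambda>k. \<beta> (i + k)) v' \<longrightarrow> below (v 0) (v' 0))" for i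
  proof -
    define Z where "Z = {v 0 | v. point_path f P (\<lambda>k. \<beta> (i + k)) v}"
    have ZP: "Z \<subseteq> P" and Zs: "\<And>z. z \<in> Z \<Longrightarrow> sgn z = \<beta> i" by (auto simp: Z_def point_path_def)
    then have "finite Z" using fin finite_subset by blast
    moreover have "Z \<noteq> {}" using point_path_shift[OF x, of i] by (auto simp: Z_def)
    ultimately obtain z where z: "z \<in> Z" "\<And>y. y \<in> Z \<Longrightarrow> cmod z \<le> cmod y"
      using ex_min_if_finite[of "cmod ` Z"] by (auto simp: not_less)
    then obtain v where "point_path f P (\<lambda>k. \<beta> (i + k)) v" "z = v 0" by (auto simp: Z_def)
    moreover have "below z (v' 0)" if "point_path f P (\<lambda>k. \<beta> (i + k)) v'" for v'
    proof -
      have "v' 0 \<in> Z" using that by (auto simp: Z_def)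
      then show ?thesis using z Zs by (auto simp: below_def)
    qed
    ultimately show ?thesis by blast
  qed
  then obtain v where v: "\<And>i. point_path f P (\<lambda>k. \<beta> (i + k)) (v i)"
    "\<And>i v'. point_path f P (\<lambda>k. \<beta> (i + k)) v' \<Longrightarrow> below (v i 0) (v' 0)" by metis
  have "point_path f P \<beta> (\<lambda>i. v i 0)"
    unfolding point_path_def
  proof (intro allI conjI)
    fix i
    show "v i 0 \<in> P" "sgn (v i 0) = \<beta> i" using v(1)[of i] by (auto simp: point_path_def)
    have "point_path f P (\<lambda>k. \<beta> (Suc i + k)) (\<lambda>k. v i (1 + k))"
      using point_path_shift[OF v(1)[of i], of 1] by simp
    then have "below (v (Suc i) 0) (v i 1)" using v(2)[of "Suc i"] by fastforce
    also have "below (v i 1) (f (v i 0))" using v(1)[of i] by (simp add: point_path_def)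
    finally show "below (v (Suc i) 0) (f (v i 0))" .
  qed
  then show ?thesis using v(2) unfolding least_path_def by blast
qed

section \<open>Backward approximations and the shadow orbit\<close>

primrec approx :: "(complex \<Rightarrow> complex) \<Rightarrow> (nat \<Rightarrow> complex) \<Rightarrow> nat \<Rightarrow> nat \<Rightarrow> complex" where
  "approx f d 0 i = d i"
| "approx f d (Suc k) i = last_pre f (d i) (approx f d k (Suc i))"

definition shadow :: "(complex \<Rightarrow> complex) \<Rightarrow> (nat \<Rightarrow> complex) \<Rightarrow> nat \<Rightarrow> complex" where
  "shadow f d i = lim (\<lambda>k. approx f d k i)"

lemma approx_cong: "(\<And>l. d (i + l) = d (j + l)) \<Longrightarrow> approx f d k i = approx f d k j"
proof (induction k arbitrary: i j)
  case 0
  then show ?case using "0"[of 0] by simp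
next
  case (Suc k)
  have "d (Suc i + l) = d (Suc j + l)" for l using Suc.prems[of "Suc l"] by simp
  then show ?case using Suc.IH[of "Suc i" "Suc j"] Suc.prems[of 0] by simp
qed

lemma shadow_cong: "(\<And>l. d (i + l) = d (j + l)) \<Longrightarrow> shadow f d i = shadow f d j"
  by (simp add: shadow_def approx_cong[of d i j])

text \<open>On a least path with \<open>\<beta> i = \<beta> j\<close>, comparing moduli is enough:
  equal points of \<open>d\<close> have successors on the same branch, so at the first difference
  the two points share a branch.\<close>

definition lex_less :: "(nat \<Rightarrow> complex) \<Rightarrow> nat \<Rightarrow> nat \<Rightarrow> bool" where
  "lex_less d i j \<longleftrightarrow> (\<exists>k. (\<forall>l<k. d (i + l) = d (j + l)) \<and> cmod (d (i + k)) < cmod (d (j + k)))"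

locale tight_path =
  fixes f :: "complex \<Rightarrow> complex" and P :: "complex set" and \<beta> d :: "nat \<Rightarrow> complex"
  assumes cycle: "(f, P) \<in> cycles" and least: "least_path f P \<beta> d"
begin

lemma f_maps: "f \<in> triod_maps" and P_in: "P \<subseteq> triod - {0}" and f_P: "f ` P = P" and fin: "finite P"
  using cycle orbit_notin_fixed[OF cycle] finite_cycle[OF cycle] by (auto simp: cycles_def)

lemma d_in: "d i \<in> P" and sgn_d: "sgn (d i) = \<beta> i" and d_step: "below (d (Suc i)) (f (d i))"
  using least by (auto simp: least_path_def point_path_def)

lemma d_T: "d i \<in> triod - {0}"
  using d_in P_in by auto

text \<open>Prepending \<open>e\<close> to the tail of \<open>d\<close> gives a competitor for
  \<open>d i\<close>. So \<open>d i\<close> is the least point of \<open>P\<close> on its branch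
  whose image covers \<open>d (Suc i)\<close>.\<close>

lemma tight:
  assumes "e \<in> P" "sgn e = \<beta> i" "below (d (Suc i)) (f e)"
  shows "below (d i) e"
proof -
  have "point_path f P (\<lambda>k. \<beta> (i + k)) (case_nat e (\<lambda>k. d (Suc i + k)))"
    using assms d_in sgn_d d_step by (auto simp: point_path_def split: nat.split)
  then show ?thesis using least unfolding least_path_def by fastforce
qed

lemma least_below: "point_path f P \<beta> v \<Longrightarrow> below (d i) (v i)"
  using least point_path_shift[of f P \<beta> v i] unfolding least_path_def by fastforce

lemma d_periodic:
  assumes "\<And>i. \<beta> (i + m) = \<beta> i" shows "d (i + m) = d i"
proof (rule below_antisym)
  have sh: "(\<lambda>k. \<beta> (i + m + k)) = (\<lambda>k. \<beta> (i + k))" for i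
    using assms by (metis add.commute add.left_commute)
  have path: "point_path f P (\<lambda>k. \<beta> (i + k)) (\<lambda>k. d (i + k))" for i
    using least point_path_shift unfolding least_path_def by blast
  have least': "below (d j) (v 0)" if "point_path f P (\<lambda>k. \<beta> (j + k)) v" for j v
    using least that unfolding least_path_def by blast
  show "below (d (i + m)) (d i)"
    using least'[of "i + m" "\<lambda>k. d (i + k)"] path[of i] sh[of i] by simp
  show "below (d i) (d (i + m))"
    using least'[of i "\<lambda>k. d (i + m + k)"] path[of "i + m"] sh[of i] by simp
qed

lemma sgn_d_Suc: "d i = d j \<Longrightarrow> \<beta> (Suc i) = \<beta> (Suc j)"
  using d_step[of i] d_step[of j] sgn_d by (metis below_def)

abbreviation "a \<equiv> approx f d"
abbreviation "t \<equiv> shadow f d"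

lemma approx_in: "a k i \<in> triod - {0} \<and> below (a k i) (d i)"
proof (induction k arbitrary: i)
  case (Suc k)
  have "below (a k (Suc i)) (f (d i))" using Suc[of "Suc i"] d_step below_trans by blast
  then show ?case using last_pre_in[OF f_maps d_T] Suc[of "Suc i"] by simp
qed (use d_T in simp)

lemma approx_step: "below (a k (Suc i)) (f (d i))"
  using approx_in d_step below_trans by blast

lemma approx_image: "f (a (Suc k) i) = a k (Suc i)"
  using last_pre_image[OF f_maps d_T _ approx_step] approx_in by simp

lemma sgn_approx: "sgn (a k i) = \<beta> i"
  using approx_in sgn_d by (metis below_def)

lemma approx_Suc_le: "cmod (a (Suc k) i) \<le> cmod (a k i)"
proof (induction k arbitrary: i)
  case 0
  then show ?case using approx_in[of 1 i] by (simp add: below_def)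
next
  case (Suc k)
  show ?case
  proof (cases "cmod (a (Suc k) (Suc i)) = cmod (a k (Suc i))")
    case True
    then have "a (Suc k) (Suc i) = a k (Suc i)" using sgn_norm_eqI sgn_approx by metis
    then show ?thesis by simp
  next
    case False
    then have "cmod (a (Suc k) (Suc i)) < cmod (a k (Suc i))" using Suc[of "Suc i"] by simp
    then show ?thesis
      using last_pre_less[OF f_maps d_T _ _ approx_step approx_step, of "Suc k" i k] approx_in
      by (metis approx.simps(2) less_imp_le)
  qed
qed

text \<open>If \<open>f e\<close> covered \<open>a k (Suc i)\<close>, the induction hypothesis would
  put \<open>f e\<close> at or beyond \<open>d (Suc i)\<close>, and tightness would put
  \<open>e\<close> at or beyond \<open>d i\<close>. So the last preimage lies beyond
  \<open>e\<close>.\<close>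

lemma less_approx: "e \<in> P \<Longrightarrow> sgn e = \<beta> i \<Longrightarrow> cmod e < cmod (d i) \<Longrightarrow> cmod e < cmod (a k i)"
proof (induction k arbitrary: i e)
  case (Suc k)
  have "\<not> below (a k (Suc i)) (f e)"
  proof
    assume b: "below (a k (Suc i)) (f e)"
    then have s: "sgn (f e) = \<beta> (Suc i)" using sgn_approx by (metis below_def)
    have "\<not> cmod (f e) < cmod (d (Suc i))"
      using Suc.IH[OF _ s] Suc.prems(1) f_P b by (force simp: below_def)
    then have "below (d (Suc i)) (f e)" using s sgn_d by (simp add: below_def)
    then show False using tight[OF Suc.prems(1,2)] Suc.prems(3) by (simp add: below_def)
  qed
  moreover have "below e (d i)" using Suc.prems sgn_d by (simp add: below_def)
  ultimately show ?case
    using last_pre_last[OF f_maps d_T _ approx_step] approx_in Suc.prems(1) P_in by auto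
qed simp

text \<open>The approximations lie on one branch and their moduli decrease. The direction is written
  \<open>\<beta> i\<close> and not \<open>sgn (t i)\<close>, because the limit may still be 0
  here.\<close>

lemma shadow_lim: "(\<lambda>k. a k i) \<longlonglongrightarrow> t i"
  and shadow_lim_norm: "(\<lambda>k. cmod (a k i)) \<longlonglongrightarrow> cmod (t i)"
  and shadow_le: "cmod (t i) \<le> cmod (a k i)"
  and shadow_in: "t i \<in> triod" "t i = cmod (t i) *\<^sub>R \<beta> i"
proof -
  have dec: "decseq (\<lambda>k. cmod (a k i))" using approx_Suc_le by (intro decseq_SucI)
  obtain L where L: "(\<lambda>k. cmod (a k i)) \<longlonglongrightarrow> L" "\<And>k. L \<le> cmod (a k i)"
    using decseq_convergent[OF dec, of 0] by auto
  have L0: "0 \<le> L" using L(1) by (rule LIMSEQ_le_const) simp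
  have b3: "\<beta> i ^ 3 = 1" using triod_cases(1) d_T sgn_d by (metis DiffD1 DiffD2 singletonI)
  have "(\<lambda>k. cmod (a k i) *\<^sub>R \<beta> i) \<longlonglongrightarrow> L *\<^sub>R \<beta> i" by (intro tendsto_intros L)
  moreover have "cmod (a k i) *\<^sub>R \<beta> i = a k i" for k
    using triod_cases(3)[of "a k i"] approx_in sgn_approx by (metis DiffD1 DiffD2 singletonI)
  ultimately have "(\<lambda>k. a k i) \<longlonglongrightarrow> L *\<^sub>R \<beta> i" by simp
  then have t: "t i = L *\<^sub>R \<beta> i" unfolding shadow_def by (rule limI)
  then have c: "cmod (t i) = L" using L0 cube_root_norm[OF b3] by simp
  show "(\<lambda>k. cmod (a k i)) \<longlonglongrightarrow> cmod (t i)" "cmod (t i) \<le> cmod (a k i)" using c L by auto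
  show "(\<lambda>k. a k i) \<longlonglongrightarrow> t i" using t \<open>(\<lambda>k. a k i) \<longlonglongrightarrow> L *\<^sub>R \<beta> i\<close> by simp
  show "t i = cmod (t i) *\<^sub>R \<beta> i" using t c by simp
  have "L \<le> 1" using L(2)[of 0] triod_cases(2)[of "d i"] d_T[of i] by auto
  then show "t i \<in> triod" using t scaleR_in_triod[OF b3 L0] by simp
qed

lemma shadow_image: "f (t i) = t (Suc i)"
proof -
  have "(\<lambda>k. f (a (Suc k) i)) \<longlonglongrightarrow> f (t i)"
    by (rule continuous_on_tendsto_compose[OF triod_mapsD(1)[OF f_maps] LIMSEQ_Suc[OF shadow_lim]])
      (use approx_in shadow_in in \<open>auto simp del: approx.simps\<close>)
  then have "(\<lambda>k. a k (Suc i)) \<longlonglongrightarrow> f (t i)" by (simp only: approx_image)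
  then show ?thesis using LIMSEQ_unique shadow_lim by blast
qed

lemma shadow_funpow: "(f ^^ n) (t i) = t (i + n)"
  by (induction n) (auto simp: shadow_image)

lemma le_shadow: "e \<in> P \<Longrightarrow> sgn e = \<beta> i \<Longrightarrow> cmod e < cmod (d i) \<Longrightarrow> cmod e \<le> cmod (t i)"
  using less_approx[of e i] by (intro LIMSEQ_le_const[OF shadow_lim_norm]) (auto intro: less_imp_le)

text \<open>Eventually \<open>a k (Suc i)\<close> is nearer to 0 than \<open>t (Suc j)\<close>,
  hence than \<open>a k (Suc j)\<close>, and last preimages preserve this. The limit yields only a
  weak inequality; it is strict because the images under \<open>f\<close> differ.\<close>

lemma shadow_step_less:
  assumes "d i = d j" "cmod (t (Suc i)) < cmod (t (Suc j))"
  shows "cmod (t i) < cmod (t j)"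
proof -
  have "eventually (\<lambda>k. cmod (a k (Suc i)) < cmod (t (Suc j))) sequentially"
    using order_tendstoD(2)[OF shadow_lim_norm assms(2)] .
  then have "eventually (\<lambda>k. cmod (a (Suc k) i) < cmod (a (Suc k) j)) sequentially"
  proof eventually_elim
    case (elim k)
    then have "cmod (a k (Suc i)) < cmod (a k (Suc j))" using shadow_le[of "Suc j" k] by simp
    then show ?case
      using last_pre_less[OF f_maps d_T _ _ approx_step _, of k i "a k (Suc j)"] approx_step[of k j] approx_in assms(1)
      by (metis approx.simps(2))
  qed
  then have "eventually (\<lambda>k. cmod (a (Suc k) i) \<le> cmod (a (Suc k) j)) sequentially"
    by eventually_elim simp
  then have "cmod (t i) \<le> cmod (t j)"
    by (intro tendsto_le[OF _ LIMSEQ_Suc[OF shadow_lim_norm] LIMSEQ_Suc[OF shadow_lim_norm]]) auto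
  moreover have "cmod (t i) \<noteq> cmod (t j)"
  proof
    assume "cmod (t i) = cmod (t j)"
    then have "t i = t j" using shadow_in(2)[of i] shadow_in(2)[of j] sgn_d assms(1) by metis
    then show False using shadow_image assms(2) by (metis less_irrefl)
  qed
  ultimately show ?thesis by simp
qed

end

text \<open>The assumption \<open>not_closest\<close> keeps the shadow away from 0, and
  \<open>not_orbit\<close> keeps it outside \<open>P\<close>.\<close>

locale periodic_tight_path = tight_path +
  fixes m :: nat
  assumes m: "0 < m" and per: "\<And>i. \<beta> (i + m) = \<beta> i"
    and not_closest: "\<exists>i. \<exists>e\<in>P. sgn e = \<beta> i \<and> cmod e < cmod (d i)"
    and not_orbit: "\<exists>i. f (d i) \<noteq> d (Suc i)"
begin

lemma shadow_periodic: "t (i + m) = t i"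
proof (rule shadow_cong)
  fix l show "d (i + m + l) = d (i + l)" using d_periodic[of m "i + l"] per by (simp add: ac_simps)
qed

lemma shadow_periodic_mult: "t (i + k * m) = t i"
  by (induction k) (auto simp: shadow_periodic add.assoc[symmetric] add.commute[of m])

lemma shadow_from: "\<exists>n. t j = (f ^^ n) (t i)"
proof -
  have "i \<le> j + i * m" using m by (cases m) auto
  then have "(f ^^ (j + i * m - i)) (t i) = t (j + i * m)" by (simp add: shadow_funpow)
  then show ?thesis using shadow_periodic_mult by metis
qed

text \<open>Since 0 is fixed and the shadow is periodic, one zero would make all its points 0. But
  at the index from \<open>not_closest\<close> a point of \<open>P\<close> bounds the shadow from
  below.\<close>

lemma shadow_nonzero: "t i \<noteq> 0"
proof
  assume 0: "t i = 0"
  obtain j e where e: "e \<in> P" "sgn e = \<beta> j" "cmod e < cmod (d j)" using not_closest by blast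
  have "(f ^^ n) 0 = 0" for n by (induction n) (auto simp: triod_mapsD(3)[OF f_maps])
  then have "t j = 0" using shadow_from[of j i] 0 by auto
  then show False using le_shadow[OF e] e(1) P_in by auto
qed

lemma shadow_T: "t i \<in> triod - {0}" and sgn_shadow: "sgn (t i) = \<beta> i"
proof -
  show "t i \<in> triod - {0}" using shadow_in shadow_nonzero by auto
  have "\<beta> i ^ 3 = 1" using triod_cases(1) d_T sgn_d by (metis DiffD1 DiffD2 singletonI)
  then show "sgn (t i) = \<beta> i"
    using shadow_in(2)[of i] shadow_nonzero[of i] sgn_scaleR_cube_root by (metis zero_less_norm_iff)
qed

lemma shadow_below: "below (t i) (d i)"
  using shadow_le[of i 0] sgn_shadow sgn_d by (simp add: below_def)

text \<open>One point in \<open>P\<close> would put the whole orbit in \<open>P\<close> and make it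
  a competitor of \<open>d\<close>. Being below \<open>d\<close>, it would equal \<open>d\<close>,
  which is not an orbit.\<close>

lemma shadow_notin: "t i \<notin> P"
proof
  assume "t i \<in> P"
  moreover have "(f ^^ n) x \<in> P" if "x \<in> P" for n x using that f_P by (induction n) auto
  ultimately have "t j \<in> P" for j using shadow_from[of j i] by auto
  then have "point_path f P \<beta> t" using sgn_shadow shadow_image by (auto simp: point_path_def)
  then have "t j = d j" for j using below_antisym least_below shadow_below by blast
  then show False using not_orbit shadow_image by metis
qed

lemma shadow_less: "cmod (t i) < cmod (d i)"
  using shadow_below[of i] shadow_notin[of i] d_in[of i] sgn_norm_eqI[of "t i" "d i"]
  by (force simp: below_def)

lemma less_shadow_of_less:
  assumes "\<beta> i = \<beta> j" "cmod (d i) < cmod (d j)" shows "cmod (t i) < cmod (t j)"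
  using shadow_less[of i] le_shadow[of "d i" j] d_in sgn_d assms by fastforce

text \<open>At the first difference \<open>d (i + k)\<close> separates the two shadow points. Going
  back through the common points, \<open>shadow_step_less\<close> preserves the inequality.\<close>

lemma lex_less_imp:
  assumes "\<beta> i = \<beta> j" "\<forall>l<k. d (i + l) = d (j + l)" "cmod (d (i + k)) < cmod (d (j + k))"
  shows "cmod (t i) < cmod (t j)"
  using assms
proof (induction k arbitrary: i j)
  case 0
  then show ?case using less_shadow_of_less[of i j] by simp
next
  case (Suc k)
  then have ij: "d i = d j" using Suc.prems(2)[rule_format, of 0] by simp
  have "cmod (t (Suc i)) < cmod (t (Suc j))"
  proof (rule Suc.IH)
    show "\<beta> (Suc i) = \<beta> (Suc j)" using sgn_d_Suc[OF ij] .
    show "\<forall>l<k. d (Suc i + l) = d (Suc j + l)" using Suc.prems(2)[rule_format, of "Suc _"] by simp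
  qed (use Suc.prems(3) in simp)
  then show ?case using shadow_step_less[OF ij] by simp
qed

lemma lex_trichotomy:
  assumes "\<beta> i = \<beta> j" "\<not> lex_less d i j" "\<not> lex_less d j i"
  shows "d (i + l) = d (j + l)"
proof (induction l rule: less_induct)
  case (less l)
  have "\<beta> (i + l) = \<beta> (j + l)"
  proof (cases l)
    case (Suc n)
    then show ?thesis using sgn_d_Suc[OF less[of n]] by simp
  qed (use assms in simp)
  moreover have "\<not> cmod (d (i + l)) < cmod (d (j + l))" "\<not> cmod (d (j + l)) < cmod (d (i + l))"
    using assms(2,3) less unfolding lex_less_def by metis+
  ultimately show ?case using sgn_d by (auto simp: not_less intro!: sgn_norm_eqI[of "d (i + l)"])
qed

text \<open>The right-hand side involves only points of \<open>P\<close> and their order. Hence the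
  pattern of the shadow does not depend on the values of \<open>f\<close> outside
  \<open>P\<close>.\<close>

lemma shadow_less_iff:
  assumes "\<beta> i = \<beta> j" shows "cmod (t i) < cmod (t j) \<longleftrightarrow> lex_less d i j"
proof
  show "lex_less d i j \<Longrightarrow> cmod (t i) < cmod (t j)"
    using lex_less_imp[OF assms] unfolding lex_less_def by blast
  assume less: "cmod (t i) < cmod (t j)"
  show "lex_less d i j"
  proof (rule ccontr)
    assume n: "\<not> lex_less d i j"
    show False
    proof (cases "lex_less d j i")
      case True
      then show ?thesis using lex_less_imp[OF assms[symmetric]] less unfolding lex_less_def by force
    next
      case False
      then have "t i = t j" using lex_trichotomy[OF assms n] by (intro shadow_cong)
      then show ?thesis using less by simp
    qed
  qed
qed

lemma shadow_cycle: "(f, range t) \<in> cycles"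
proof -
  have "orbit f (t 0) = range t"
  proof
    show "orbit f (t 0) \<subseteq> range t" by (auto simp: orbit_altdef shadow_funpow)
    show "range t \<subseteq> orbit f (t 0)"
    proof clarify
      fix i
      \<comment> \<open>The shift by \<open>m\<close> makes the number of iterations positive, as
        \<open>orbit\<close> demands.\<close>
      have "t i = (f ^^ (i + m)) (t 0)" by (simp add: shadow_funpow shadow_periodic)
      then show "t i \<in> orbit f (t 0)" using m unfolding orbit_altdef by blast
    qed
  qed
  then have "cyclic_on f (range t)" unfolding cyclic_on_def by auto
  then show ?thesis using f_maps shadow_T by (auto simp: cycles_def)
qed

end

section \<open>Periodic sums and the rotation number of the shadow\<close>

lemma cycle_card:
  assumes c: "(f, P) \<in> cycles" and x: "x \<in> P"
  shows "(f ^^ card P) x = x" "inj_on (\<lambda>n. (f ^^ n) x) {..<card P}"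
    "P = (\<lambda>n. (f ^^ n) x) ` {..<card P}"
proof -
  have per: "x \<in> orbit f x" and P: "P = orbit f x"
    using c x unfolding cycles_def cyclic_on_alldef by blast+
  let ?n = "funpow_dist1 f x x"
  have inj: "inj_on (\<lambda>n. (f ^^ n) x) {..<?n}"
    using inj_on_funpow_dist1[OF per] by (simp add: atLeast0LessThan)
  have im: "P = (\<lambda>n. (f ^^ n) x) ` {..<?n}"
    using orbit_conv_funpow_dist1[OF per] P by (simp add: atLeast0LessThan)
  have card: "card P = ?n" using card_image[OF inj] im by simp
  show "(f ^^ card P) x = x" using funpow_dist1_prop[OF per] card by simp
  show "inj_on (\<lambda>n. (f ^^ n) x) {..<card P}" "P = (\<lambda>n. (f ^^ n) x) ` {..<card P}"
    using inj im card by simp_all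
qed

lemma periodic_mult:
  fixes q :: nat
  assumes "\<And>i. a (i + q) = a i" shows "a (i + q * k) = a i"
proof (induction k)
  case (Suc k)
  then show ?case using assms[of "i + q * k"] by (simp add: ac_simps)
qed simp

lemma sum_periodic:
  fixes a :: "nat \<Rightarrow> real"
  assumes "\<And>i. a (i + q) = a i"
  shows "sum a {..<q * k} = real k * sum a {..<q}"
proof (induction k)
  case (Suc k)
  have "sum a {..<q * Suc k} = sum a {..<q * k} + sum a {q * k..<q * k + q}"
    by (simp add: sum.atLeastLessThan_concat[of 0] lessThan_atLeast0 add.commute)
  also have "sum a {q * k..<q * k + q} = (\<Sum>i<q. a (i + q * k))"
    using sum.shift_bounds_nat_ivl[of a 0 "q * k" q] by (simp add: lessThan_atLeast0 add.commute)
  finally show ?case using Suc periodic_mult[of a q, OF assms] by (simp add: algebra_simps)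
qed simp

text \<open>Both sides are the mean over \<open>q * m\<close> terms. This is applied to the shadow,
  whose least period may be smaller than \<open>m\<close>.\<close>

lemma mean_periodic:
  fixes a :: "nat \<Rightarrow> real"
  assumes "\<And>i. a (i + q) = a i" "\<And>i. a (i + m) = a i" "0 < q" "0 < m"
  shows "sum a {..<q} / real q = sum a {..<m} / real m"
  using sum_periodic[of a q m, OF assms(1)] sum_periodic[of a m q, OF assms(2)] assms(3,4)
  by (simp add: field_simps)

lemma (in periodic_tight_path) rotation_number_shadow:
  assumes b: "branch_numbering b" and A: "A \<in> patterns" "(f, range t) \<in> A"
  shows "rotation_number b A = (\<Sum>i<m. branch_dist b (t i) (t (Suc i))) / real m"
proof -
  define a where "a i = branch_dist b (t i) (t (Suc i))" for i
  let ?q = "card (range t)"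
  have ret: "t ?q = t 0"
    using cycle_card(1)[OF shadow_cycle, of "t 0"] by (simp add: shadow_funpow)
  have tq: "t (i + ?q) = t i" for i
    using shadow_funpow[of i ?q] shadow_funpow[of i 0] ret by (simp add: add.commute)
  have "0 < ?q" using finite_cycle[OF shadow_cycle] by (simp add: card_gt_0_iff)
  have "rotation_number b A = sum a {..<?q} / real ?q"
    using rotation_number_eq[OF b A, of "t 0"]
    by (simp add: rotation_pair_def a_def shadow_funpow shadow_image del: funpow.simps funpow_simps_right)
  also have "\<dots> = sum a {..<m} / real m"
  proof (rule mean_periodic)
    show "a (i + ?q) = a i" for i using tq[of i] tq[of "Suc i"] by (simp add: a_def)
    show "a (i + m) = a i" for i
      using shadow_periodic[of i] shadow_periodic[of "Suc i"] by (simp add: a_def)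
  qed (use \<open>0 < ?q\<close> m in auto)
  finally show ?thesis by (simp add: a_def)
qed

section \<open>Order isomorphisms and the pattern of the shadow\<close>

lemma order_iso_inj:
  assumes hs: "\<And>x. x \<in> P \<Longrightarrow> sgn (h x) = sgn x"
    and ho: "\<And>x y. x \<in> P \<Longrightarrow> y \<in> P \<Longrightarrow> sgn x = sgn y \<Longrightarrow> cmod (h x) < cmod (h y) \<longleftrightarrow> cmod x < cmod y"
  shows "inj_on h P"
proof (rule inj_onI)
  fix x y assume xy: "x \<in> P" "y \<in> P" "h x = h y"
  then have s: "sgn x = sgn y" using hs by metis
  have "cmod x = cmod y" using ho[OF xy(1,2) s] ho[OF xy(2,1) s[symmetric]] xy(3) by auto
  then show "x = y" by (rule sgn_norm_eqI[OF s])
qed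

text \<open>Pulling the shadow back by \<open>h\<close> enumerates \<open>P\<close> as an orbit
  \<open>u\<close> with the branches \<open>\<beta>\<close>, so \<open>d\<close> is below
  \<open>u\<close>. A difference between \<open>d\<close> and \<open>u\<close> would persist
  forever, but \<open>u\<close> returns to the point of \<open>P\<close> closest to 0, where
  \<open>d\<close> must agree with it. So \<open>d\<close> equals the orbit \<open>u\<close>,
  against \<open>not_orbit\<close>.\<close>

lemma (in periodic_tight_path) shadow_not_equivalent:
  assumes hP: "h ` P = range t" and hf: "\<And>x. x \<in> P \<Longrightarrow> h (f x) = f (h x)"
    and hs: "\<And>x. x \<in> P \<Longrightarrow> sgn (h x) = sgn x"
    and ho: "\<And>x y. x \<in> P \<Longrightarrow> y \<in> P \<Longrightarrow> sgn x = sgn y \<Longrightarrow> cmod (h x) < cmod (h y) \<longleftrightarrow> cmod x < cmod y"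
  shows False
proof -
  have inj: "inj_on h P" using order_iso_inj[of P h] hs ho by blast
  define u where "u i = inv_into P h (t i)" for i
  have uP: "u i \<in> P" and hu: "h (u i) = t i" for i
    unfolding u_def using hP by (auto intro: inv_into_into f_inv_into_f)
  have us: "sgn (u i) = \<beta> i" for i using hs[OF uP] hu sgn_shadow by metis
  have fP: "f x \<in> P" if "x \<in> P" for x using that f_P by blast
  have fu: "f (u i) = u (Suc i)" for i
  proof -
    have "h (f (u i)) = h (u (Suc i))" using hf[OF uP] hu shadow_image by simp
    then show ?thesis using inj_onD[OF inj] fP uP by blast
  qed
  have "point_path f P \<beta> u" using uP us fu by (simp add: point_path_def)
  note du = least_below[OF this]
  have uper: "u (i + m) = u i" for i by (simp add: u_def shadow_periodic)
  have u_surj: "\<exists>j. u j = x" if x: "x \<in> P" for x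
  proof -
    obtain j where "h x = t j" using x hP by blast
    then have "h (u j) = h x" by (simp add: hu)
    then have "u j = x" using inj_onD[OF inj _ uP x] by blast
    then show ?thesis by blast
  qed
  \<comment> \<open>With \<open>d i = u j\<close>, the order isomorphism gives \<open>t j\<close>
    nearer than \<open>t i\<close>, but \<open>t (Suc i)\<close> nearer than
    \<open>t (Suc j)\<close>. The latter gives \<open>below (d (Suc i)) (d (Suc j))\<close>, so
    tightness and \<open>du\<close> yield \<open>d i = d j\<close>; then
    \<open>shadow_step_less\<close> reverses the first inequality.\<close>
  have step: "d (Suc i) \<noteq> u (Suc i)" if ne: "d i \<noteq> u i" for i
  proof
    assume eq: "d (Suc i) = u (Suc i)"
    obtain j where j: "u j = d i" using u_surj[OF d_in] by blast
    have s: "\<beta> j = \<beta> i" using us j sgn_d by metis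
    have "cmod (u j) < cmod (u i)" using below_less[OF du ne] j by simp
    then have tji: "cmod (t j) < cmod (t i)"
      using ho[OF uP uP, of j i] us s hu by simp
    have fdi: "f (d i) = u (Suc j)" using fu j by metis
    have s': "\<beta> (Suc j) = \<beta> (Suc i)" using d_step[of i] fdi us sgn_d by (metis below_def)
    have ne': "u (Suc j) \<noteq> u (Suc i)"
    proof
      assume "u (Suc j) = u (Suc i)"
      then have "f (u j) = f (u i)" using fu by simp
      moreover have "inj_on f P" using f_P fin by (simp add: eq_card_imp_inj_on)
      ultimately have "u j = u i" using inj_onD uP by metis
      then show False using j ne by simp
    qed
    have "below (u (Suc i)) (u (Suc j))" using d_step[of i] fdi eq by simp
    then have "cmod (u (Suc i)) < cmod (u (Suc j))" using ne' below_less by metis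
    then have tless: "cmod (t (Suc i)) < cmod (t (Suc j))"
      using ho[OF uP uP, of "Suc i" "Suc j"] us s' hu by simp
    have "\<not> cmod (d (Suc j)) < cmod (d (Suc i))"
      using less_shadow_of_less[OF s'] tless by force
    then have "below (d (Suc i)) (d (Suc j))" using s' sgn_d by (simp add: below_def)
    also have "below \<dots> (f (d j))" by (rule d_step)
    finally have "below (d i) (d j)" using tight[OF d_in] sgn_d s by simp
    moreover have "below (d j) (d i)" using du[of j] j by simp
    ultimately have "d i = d j" by (rule below_antisym)
    then show False using shadow_step_less[OF _ tless] tji by simp
  qed
  have all: "d i = u i" for i
  proof (rule ccontr)
    assume ne: "d i \<noteq> u i"
    have later: "d (i + n) \<noteq> u (i + n)" for n
      by (induction n) (use ne step in auto)
    \<comment> \<open>Nothing in \<open>P\<close> is nearer to 0 than \<open>z\<close>, so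
      \<open>d\<close> cannot be strictly below \<open>u\<close> at a visit to \<open>z\<close>;
      adding \<open>m * i\<close> finds such a visit after \<open>i\<close>.\<close>
    obtain z where z: "z \<in> P" "\<And>y. y \<in> P \<Longrightarrow> cmod z \<le> cmod y"
      using ex_min_if_finite[of "cmod ` P"] fin d_in by (auto simp: not_less)
    obtain k where k: "u k = z" using u_surj z by blast
    have "u (k + m * i) = z" using periodic_mult[of u m, OF uper] k by simp
    then have "\<not> cmod (d (k + m * i)) < cmod (u (k + m * i))" using z(2)[OF d_in] by (simp add: not_less)
    then have "d (k + m * i) = u (k + m * i)" using below_less[OF du] by blast
    moreover have "i \<le> k + m * i" using m by (cases m) auto
    ultimately show False using later[of "k + m * i - i"] by simp
  qed
  then show False using not_orbit fu by metis
qed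

text \<open>All conditions on a least path concern only points of \<open>P\<close>, their images,
  their branches and their order on branches. Thus every cycle of the same pattern has a
  corresponding path and a shadow of its own.\<close>

lemma tight_path_transport:
  assumes base: "periodic_tight_path f P \<beta> d m" and c: "(g, Q) \<in> cycles"
    and hP: "h ` P = Q" and hf: "\<And>x. x \<in> P \<Longrightarrow> h (f x) = g (h x)"
    and hs: "\<And>x. x \<in> P \<Longrightarrow> sgn (h x) = sgn x"
    and ho: "\<And>x y. x \<in> P \<Longrightarrow> y \<in> P \<Longrightarrow> sgn x = sgn y \<Longrightarrow> cmod (h x) < cmod (h y) \<longleftrightarrow> cmod x < cmod y"
  shows "periodic_tight_path g Q \<beta> (\<lambda>i. h (d i)) m"
    and "\<beta> i = \<beta> j \<Longrightarrow> lex_less (\<lambda>i. h (d i)) i j \<longleftrightarrow> lex_less d i j"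
proof -
  interpret periodic_tight_path f P \<beta> d m by fact
  have inj: "inj_on h P" using order_iso_inj[of P h] hs ho by blast
  have fP: "f x \<in> P" if "x \<in> P" for x using that f_P by blast
  have below_h: "below (h x) (h y) \<longleftrightarrow> below x y" if "x \<in> P" "y \<in> P" for x y
    using that hs ho[OF that(2,1)] by (auto simp: below_def not_less[symmetric])
  have path: "point_path g Q \<gamma> (\<lambda>i. h (v i)) \<longleftrightarrow> point_path f P \<gamma> v" if "\<And>i. v i \<in> P" for \<gamma> v
    using that hP hs hf below_h fP by (auto simp: point_path_def) (metis)+
  have least': "least_path g Q \<beta> (\<lambda>i. h (d i))"
    unfolding least_path_def
  proof (intro conjI allI impI)
    show "point_path g Q \<beta> (\<lambda>i. h (d i))" using path[OF d_in] least by (simp add: least_path_def)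
    fix i w assume w: "point_path g Q (\<lambda>k. \<beta> (i + k)) w"
    define v where "v k = inv_into P h (w k)" for k
    have v: "v k \<in> P" "h (v k) = w k" for k
      using w hP unfolding v_def point_path_def by (auto intro: inv_into_into f_inv_into_f)
    then have "point_path f P (\<lambda>k. \<beta> (i + k)) v" using path[OF v(1)] w by simp
    then have "below (d i) (v 0)" using least by (simp add: least_path_def)
    then show "below (h (d i)) (w 0)" using below_h[OF d_in v(1)] v(2) by metis
  qed
  show "periodic_tight_path g Q \<beta> (\<lambda>i. h (d i)) m"
  proof unfold_locales
    show "\<exists>i. \<exists>e\<in>Q. sgn e = \<beta> i \<and> cmod e < cmod (h (d i))"
    proof -
      obtain i e where e: "e \<in> P" "sgn e = \<beta> i" "cmod e < cmod (d i)" using not_closest by blast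
      then have "cmod (h e) < cmod (h (d i))" "sgn (h e) = \<beta> i"
        using ho[OF e(1) d_in] hs sgn_d by simp_all
      then show ?thesis using e(1) hP by blast
    qed
    obtain i where "f (d i) \<noteq> d (Suc i)" using not_orbit by blast
    then have "h (f (d i)) \<noteq> h (d (Suc i))" using inj_onD[OF inj] fP d_in by metis
    then show "\<exists>i. g (h (d i)) \<noteq> h (d (Suc i))" using hf[OF d_in] by metis
  qed (use c least' m per in auto)
  assume ij: "\<beta> i = \<beta> j"
  have eq: "h (d i) = h (d j) \<longleftrightarrow> d i = d j" for i j
    by (rule inj_on_eq_iff[OF inj d_in d_in])
  have "(\<forall>l<k. d (i + l) = d (j + l)) \<Longrightarrow> \<beta> (i + k) = \<beta> (j + k)" for k
  proof (cases k)
    case (Suc n)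
    assume "\<forall>l<k. d (i + l) = d (j + l)"
    then show ?thesis using sgn_d_Suc[of "i + n" "j + n"] Suc by simp
  qed (use ij in simp)
  then have "(\<forall>l<k. d (i + l) = d (j + l)) \<Longrightarrow>
      cmod (h (d (i + k))) < cmod (h (d (j + k))) \<longleftrightarrow> cmod (d (i + k)) < cmod (d (j + k))" for k
    using ho[OF d_in d_in] sgn_d by simp
  then show "lex_less (\<lambda>i. h (d i)) i j \<longleftrightarrow> lex_less d i j"
    unfolding lex_less_def eq by blast
qed

section \<open>Green points and loops\<close>

text \<open>The coordinate of the image minus that of the point is negative at \<open>p\<close>,
  which leaves the branch. If \<open>f x\<close> lay beyond \<open>x\<close>, it would vanish in
  between, at a nonzero fixed point.\<close>

lemma green_below:
  assumes f: "f \<in> triod_maps" and x: "x \<in> triod - {0}" and p: "p \<in> triod - {0}" "below p x"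
    and fp: "sgn (f p) \<noteq> sgn p" and fx: "sgn (f x) = sgn x"
  shows "below (f x) x"
proof (rule ccontr)
  assume "\<not> below (f x) x"
  then have less: "cmod x < cmod (f x)" using fx by (simp add: below_def)
  define w where "w = sgn x"
  have w: "w ^ 3 = 1" using triod_cases(1) x by (auto simp: w_def)
  have pw: "p = cmod p *\<^sub>R w" and xw: "x = cmod x *\<^sub>R w"
    using triod_cases(3)[of p] triod_cases(3)[of x] p x by (auto simp: w_def below_def)
  define F where "F s = arm_coord w (f (s *\<^sub>R w)) - s" for s
  have fT: "f p \<in> triod" "f x \<in> triod" using triod_mapsD(2)[OF f] p x by auto
  have "F (cmod p) = - cmod p"
    using arm_coord_other[OF fT(1) w] fp p(2) pw by (simp add: F_def w_def below_def)
  then have "F (cmod p) \<le> 0" by simp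
  moreover have "0 \<le> F (cmod x)"
    using arm_coord_sgn[OF fT(2)] fx less xw by (simp add: F_def w_def)
  moreover have "continuous_on {0..cmod x} F"
    unfolding F_def w_def by (intro continuous_intros continuous_on_segment f x)
  then have "continuous_on {cmod p..cmod x} F" by (rule continuous_on_subset) auto
  ultimately have "\<exists>s\<ge>cmod p. s \<le> cmod x \<and> F s = 0"
    using p(2) by (intro IVT') (auto simp: below_def)
  then obtain s where s: "cmod p \<le> s" "s \<le> cmod x" "F s = 0" by auto
  then have s0: "0 < s" using p by (metis DiffD2 singletonI less_le_trans zero_less_norm_iff)
  have sT: "s *\<^sub>R w \<in> triod" using segment_in_triod[OF x, of s] s s0 by (simp add: w_def)
  have "f (s *\<^sub>R w) = s *\<^sub>R w"
    using arm_coord_pos(3)[OF triod_mapsD(2)[OF f sT] w] s(3) s0 by (simp add: F_def)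
  then have "s *\<^sub>R w = 0" using triod_mapsD(4)[OF f sT] by simp
  then show False using s0 w by auto
qed

text \<open>The base point is listed at the head, and appending \<open>p\<close> covers the closing
  step. So loops with the same base point can be joined by \<open>@\<close>.\<close>

definition loop_at :: "(complex \<Rightarrow> complex) \<Rightarrow> complex set \<Rightarrow> complex \<Rightarrow> complex list \<Rightarrow> bool" where
  "loop_at f P p xs \<longleftrightarrow> xs \<noteq> [] \<and> hd xs = p \<and> set xs \<subseteq> P \<and>
     successively (\<lambda>x y. below y (f x)) (xs @ [p])"

lemma loop_at_append: "loop_at f P p xs \<Longrightarrow> loop_at f P p ys \<Longrightarrow> loop_at f P p (xs @ ys)"
  by (auto simp: loop_at_def successively_append_iff)

lemma loop_at_replicate:
  "loop_at f P p xs \<Longrightarrow> loop_at f P p ys \<Longrightarrow> loop_at f P p (concat (replicate k xs) @ ys)"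
  by (induction k) (auto intro: loop_at_append)

lemma loop_at_path:
  assumes "loop_at f P p xs"
  shows "point_path f P (\<lambda>i. sgn (xs ! (i mod length xs))) (\<lambda>i. xs ! (i mod length xs))"
  unfolding point_path_def
proof (intro allI conjI)
  fix i
  define j where "j = i mod length xs"
  have j: "j < length xs" using assms by (simp add: j_def loop_at_def)
  then show "xs ! (i mod length xs) \<in> P" using assms by (auto simp: loop_at_def j_def)
  have "below ((xs @ [p]) ! Suc j) (f ((xs @ [p]) ! j))"
    using assms j by (simp add: loop_at_def successively_conv_nth)
  moreover have "(xs @ [p]) ! Suc j = xs ! (Suc i mod length xs)"
  proof (cases "Suc j = length xs")
    case True
    then show ?thesis using assms by (auto simp: nth_append mod_Suc j_def loop_at_def hd_conv_nth)
  next
    case False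
    then have "Suc j < length xs" using j by simp
    then show ?thesis using False by (simp add: nth_append mod_Suc j_def)
  qed
  ultimately show "below (xs ! (Suc i mod length xs)) (f (xs ! (i mod length xs)))"
    using j by (simp add: nth_append j_def)
qed simp

text \<open>The jump over the omitted point goes inwards, so it is an admissible step of a loop.\<close>

lemma loop_at_omit:
  assumes c: "(f, P) \<in> cycles" and p: "p \<in> P" and x: "x \<in> P" "x \<noteq> p" and fx: "below (f x) x"
  obtains ys where "loop_at f P p ys" "length ys = card P - 1"
    "\<And>k :: complex \<Rightarrow> real. sum_list (map k ys) = (\<Sum>y\<in>P. k y) - k x"
proof -
  define g where "g = (\<lambda>i. (f ^^ i) p)"
  define n where "n = card P"
  have gn: "g n = p" and inj: "inj_on g {..<n}" and im: "P = g ` {..<n}"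
    using cycle_card[OF c p] by (auto simp: g_def n_def)
  have gS: "f (g i) = g (Suc i)" for i by (simp add: g_def)
  obtain j where j: "j < n" "g j = x" using x im by auto
  have j0: "0 < j" using j x by (cases j) (auto simp: g_def)
  define js where "js = [0..<j] @ [Suc j..<n]"
  have up: "successively (\<lambda>x y. below y (f x)) (map g [a..<b])" for a b
    by (auto simp: successively_conv_nth gS)
  \<comment> \<open>Index \<open>n\<close> stands for the return to \<open>p\<close>, so the jump
    from \<open>j - 1\<close> to \<open>Suc j\<close> makes sense also when \<open>x\<close> is the
    last point.\<close>
  have "map g js @ [p] = map g [0..<j] @ map g [Suc j..<Suc n]" using j gn by (simp add: js_def)
  moreover have "below (g (Suc j)) (f (g (j - 1)))" using j0 gS j(2) fx by (metis Suc_pred')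
  ultimately have "successively (\<lambda>x y. below y (f x)) (map g js @ [p])"
    using up[of 0 j] up[of "Suc j" "Suc n"] j j0
    by (auto simp: successively_append_iff last_map hd_map hd_append simp del: upt_Suc)
  moreover have "hd (map g js) = p" using j0 by (simp add: js_def hd_append hd_map g_def)
  moreover have "set (map g js) \<subseteq> P" using im j by (auto simp: js_def)
  moreover have "map g js \<noteq> []" using j0 by (simp add: js_def)
  ultimately have "loop_at f P p (map g js)" by (simp add: loop_at_def)
  moreover have "length (map g js) = card P - 1" using j by (simp add: js_def n_def)
  moreover have "sum_list (map k (map g js)) = (\<Sum>y\<in>P. k y) - k x" for k :: "complex \<Rightarrow> real"
  proof -
    have "sum_list (map k (map g js)) = (\<Sum>i=0..<j. k (g i)) + (\<Sum>i=Suc j..<n. k (g i))"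
      by (simp add: js_def interv_sum_list_conv_sum_set_nat o_def)
    moreover have "(\<Sum>y\<in>P. k y) = (\<Sum>i=0..<n. k (g i))"
      using sum.reindex[OF inj, of k] im by (simp add: lessThan_atLeast0)
    moreover have "\<dots> = (\<Sum>i=0..<j. k (g i)) + (\<Sum>i=j..<n. k (g i))"
      using j by (simp add: sum.atLeastLessThan_concat)
    moreover have "(\<Sum>i=j..<n. k (g i)) = k (g j) + (\<Sum>i=Suc j..<n. k (g i))"
      using j by (simp add: sum.atLeast_Suc_lessThan)
    ultimately show ?thesis using j by simp
  qed
  ultimately show ?thesis using that by blast
qed


subsection \<open>Green points force a second pattern\<close>

lemma branch_dist_zeroD:
  assumes b: "branch_numbering b" and uv: "u \<in> triod - {0}" "v \<in> triod - {0}" and 0: "branch_dist b u v = 0"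
  shows "sgn v = sgn u"
proof -
  obtain i k where *: "i < 3" "k < 3" "u \<in> b i" "v \<in> b ((i + k) mod 3)" "branch_dist b u v = real k / 3"
    using branch_dist_ex[OF b uv] .
  then have "v \<in> b i" using 0 by simp
  then show ?thesis using mem_branch_iff[OF branch_numbering_in[OF b *(1)] *(3)] by blast
qed

lemma branch_dist_thirdD:
  assumes b: "branch_numbering b" and uv: "u \<in> triod - {0}" "v \<in> triod - {0}" and 3: "branch_dist b u v = 1 / 3"
    and i: "i < 3" "u \<in> b i"
  shows "v \<in> b ((i + 1) mod 3)"
proof -
  obtain j k where *: "j < 3" "k < 3" "u \<in> b j" "v \<in> b ((j + k) mod 3)" "branch_dist b u v = real k / 3"
    using branch_dist_ex[OF b uv] .
  then have "j = i" "k = 1" using branch_numbering_unique[OF b _ i(1) _ i(2)] 3 by simp_all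
  then show ?thesis using * by simp
qed

lemma patterns_equiv:
  "A \<in> patterns \<Longrightarrow> c \<in> A \<Longrightarrow> c' \<in> A \<Longrightarrow> (c, c') \<in> cycle_equiv"
  using equiv_cycle_equiv quotient_eq_iff unfolding patterns_def by metis

text \<open>For \<open>g\<close> exhibiting \<open>A\<close>, the transported path has a shadow
  under \<open>g\<close>. Both shadows are ordered by the same lexicographic comparison, hence they
  are equivalent cycles.\<close>

lemma forces_shadow:
  assumes A: "A \<in> patterns" "(f, P) \<in> A" and base: "periodic_tight_path f P \<beta> d m" and multi: "\<beta> i \<noteq> \<beta> j"
  defines "B \<equiv> cycle_equiv `` {(f, range (shadow f d))}"
  shows "B \<in> patterns" "(f, range (shadow f d)) \<in> B" "forces A B" "B \<noteq> A"
proof -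
  interpret periodic_tight_path f P \<beta> d m by fact
  show B: "B \<in> patterns" "(f, range t) \<in> B"
    unfolding B_def patterns_def
    by (rule quotientI[OF shadow_cycle], rule equiv_class_self[OF equiv_cycle_equiv shadow_cycle])
  have multi_d: "d i \<in> P" "d j \<in> P" "sgn (d i) \<noteq> sgn (d j)" using d_in sgn_d multi by auto
  show "forces A B"
    unfolding forces_def
  proof clarify
    fix g Q assume "(g, Q) \<in> A"
    then have e: "((f, P), (g, Q)) \<in> cycle_equiv" using patterns_equiv A by blast
    then have c: "(g, Q) \<in> cycles" by (auto simp: cycle_equiv_def)
    obtain h where h: "h ` P = Q" "\<And>x. x \<in> P \<Longrightarrow> h (f x) = g (h x)" "\<And>x. x \<in> P \<Longrightarrow> sgn (h x) = sgn x"
      "\<And>x y. x \<in> P \<Longrightarrow> y \<in> P \<Longrightarrow> sgn x = sgn y \<Longrightarrow> cmod (h x) < cmod (h y) \<longleftrightarrow> cmod x < cmod y"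
      using cycle_order_iso[OF e multi_d] by blast
    interpret g: periodic_tight_path g Q \<beta> "\<lambda>i. h (d i)" m
      by (rule tight_path_transport(1)[OF base c h])
    have "((f, range t), (g, range g.t)) \<in> cycle_equiv"
    proof (rule cycle_equivI[OF shadow_cycle g.shadow_cycle shadow_image g.shadow_image])
      show "sgn (g.t k) = sgn (t k)" for k by (simp add: sgn_shadow g.sgn_shadow)
      show "sgn (t i) \<noteq> sgn (t j)" using multi by (simp add: sgn_shadow)
      fix k l assume "sgn (t k) = sgn (t l)"
      then have kl: "\<beta> k = \<beta> l" by (simp add: sgn_shadow)
      show "cmod (g.t k) < cmod (g.t l) \<longleftrightarrow> cmod (t k) < cmod (t l)"
        unfolding shadow_less_iff[OF kl] g.shadow_less_iff[OF kl]
        by (rule tight_path_transport(2)[OF base c h kl])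
    qed
    then show "\<exists>R. (g, R) \<in> B" unfolding B_def by blast
  qed
  show "B \<noteq> A"
  proof
    assume "B = A"
    then have e: "((f, P), (f, range t)) \<in> cycle_equiv" using patterns_equiv A B(2) by blast
    show False
      by (rule cycle_order_iso[OF e multi_d]) (rule shadow_not_equivalent)
  qed
qed

lemma green_tight_path:
  assumes b: "branch_numbering b" and c: "(f, P) \<in> cycles"
    and p: "\<And>i. i < 3 \<Longrightarrow> p i \<in> P \<inter> b i \<and> (\<forall>y\<in>P \<inter> b i. cmod (p i) \<le> cmod y) \<and> black b f (p i)"
    and x: "x \<in> P" "green b f x"
    and \<rho>: "(\<Sum>y\<in>P. branch_dist b y (f y)) / real (card P) > 1 / 3"
  obtains \<beta> d m where "periodic_tight_path f P \<beta> d m" "\<beta> 0 \<noteq> \<beta> (Suc 0)"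
    "(\<Sum>i<m. branch_dist b (shadow f d i) (shadow f d (Suc i))) / real m =
     (\<Sum>y\<in>P. branch_dist b y (f y)) / real (card P)"
proof -
  define k where "k y = branch_dist b y (f y)" for y
  have f: "f \<in> triod_maps" using c by (auto simp: cycles_def)
  have PT: "P \<subseteq> triod - {0}" and fP: "f ` P = P" using orbit_notin_fixed[OF c] by auto
  have fin: "finite P" using finite_cycle[OF c] .
  have T: "y \<in> triod - {0}" "f y \<in> triod - {0}" if "y \<in> P" for y using that PT fP by auto
  have pP: "p i \<in> P" "p i \<in> b i" if "i < 3" for i using p[OF that] by auto
  have p_min: "below (p i) y" if "i < 3" "y \<in> P" "y \<in> b i" for i y
    using p[OF that(1)] that mem_branch_iff[OF branch_numbering_in[OF b that(1)] pP(2)[OF that(1)]]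
    by (auto simp: below_def)
  have k_p: "k (p i) = 1 / 3" if "i < 3" for i using p[OF that] by (simp add: k_def black_def)
  have fp: "f (p i) \<in> b ((i + 1) mod 3)" if "i < 3" for i
    using branch_dist_thirdD[OF b T[OF pP(1)[OF that]] _ that pP(2)[OF that]] k_p[OF that] by (simp add: k_def)
  have fP': "f y \<in> P" if "y \<in> P" for y using that fP by blast
  have p_step: "below (p ((i + 1) mod 3)) (f (p i))" if "i < 3" for i
    using p_min[of "(i + 1) mod 3"] fp[OF that] fP' pP(1)[OF that] by simp
  have p_sgn: "sgn (p i) \<noteq> sgn (p j)" if "i < 3" "j < 3" "i \<noteq> j" for i j
  proof
    assume "sgn (p i) = sgn (p j)"
    then have "p i \<in> b j"
      using mem_branch_iff[OF branch_numbering_in[OF b that(2)] pP(2)[OF that(2)]] T(1)[OF pP(1)[OF that(1)]] by simp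
    then show False using branch_numbering_unique[OF b that(1,2) pP(2)[OF that(1)]] that(3) by blast
  qed
  have kx: "k x = 0" using x by (simp add: k_def green_def)
  obtain j where j: "j < 3" "x \<in> b j" using branch_numbering_ex[OF b T(1)[OF x(1)]] by blast
  have fx: "below (f x) x"
  proof (rule green_below[OF f T(1)[OF x(1)] T(1)[OF pP(1)[OF j(1)]]])
    show "below (p j) x" using p_min j x by blast
    show "sgn (f x) = sgn x" using branch_dist_zeroD[OF b T[OF x(1)]] kx by (simp add: k_def)
    have "sgn (f (p j)) = sgn (p ((j + 1) mod 3))" using p_step[OF j(1)] by (simp add: below_def)
    moreover have "(j + 1) mod 3 \<noteq> j" using j(1) by presburger
    ultimately show "sgn (f (p j)) \<noteq> sgn (p j)" using p_sgn j(1) by simp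
  qed
  have xp: "x \<noteq> p i" if "i < 3" for i using k_p[OF that] kx by auto
  obtain ys where ys: "loop_at f P (p 0) ys" "length ys = card P - 1" "sum_list (map k ys) = (\<Sum>y\<in>P. k y)"
    using loop_at_omit[OF c pP(1)[of 0] x(1) xp[of 0] fx] kx by (metis diff_zero zero_less_numeral)
  have tri: "loop_at f P (p 0) [p 0, p 1, p 2]"
    using pP(1) p_step[of 0] p_step[of 1] p_step[of 2] by (simp add: loop_at_def numeral_2_eq_2)
  have "\<exists>c::nat. k y = real c / 3" if "y \<in> P" for y
    using branch_dist_ex[OF b T[OF that]] unfolding k_def by metis
  then obtain c' :: "complex \<Rightarrow> nat" where c': "\<And>y. y \<in> P \<Longrightarrow> k y = real (c' y) / 3" by metis
  define N where "N = (\<Sum>y\<in>P. c' y)"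
  define n where "n = card P"
  have n: "0 < n" using fin x by (auto simp: n_def card_gt_0_iff)
  have N: "(\<Sum>y\<in>P. k y) = real N / 3" by (simp add: N_def c' sum_divide_distrib)
  \<comment> \<open>The rotation number is \<open>N / (3 * n)\<close>, so it exceeds 1/3 exactly if
    \<open>n < N\<close>. This also makes the subtractions below exact.\<close>
  have nN: "n < N" using \<rho> N n by (simp add: k_def[symmetric] n_def[symmetric] field_simps)
  \<comment> \<open>The triangle has rotation 1 and length 3, \<open>ys\<close> has rotation
    \<open>N / 3\<close> and length \<open>n - 1\<close>. Taking \<open>N\<close> triangles and
    \<open>3 * (N - n)\<close> copies of \<open>ys\<close> gives the mean
    \<open>N / (3 * n)\<close>. One triangle is split off, so that the loop starts with it.\<close>
  define rest where "rest = concat (replicate (N - 1) [p 0, p 1, p 2]) @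
    (concat (replicate (3 * (N - n) - 1) ys) @ ys)"
  have rest: "loop_at f P (p 0) rest"
    unfolding rest_def by (intro loop_at_replicate tri ys)
  define xs where "xs = [p 0, p 1, p 2] @ rest"
  have xs: "loop_at f P (p 0) xs" unfolding xs_def by (intro loop_at_append tri rest)
  define m where "m = length xs"
  have sum_rep: "sum_list (map g (concat (replicate q zs))) = real q * sum_list (map g zs)"
    for g :: "complex \<Rightarrow> real" and q zs by (induction q) (auto simp: algebra_simps)
  have len_rep: "real (length (concat (replicate q zs))) = real q * real (length zs)"
    for q and zs :: "complex list" by (induction q) (auto simp: algebra_simps)
  have real_N: "real (N - 1) = real N - 1" "real (3 * (N - n) - 1) = 3 * (real N - real n) - 1"
    "real (n - 1) = real n - 1" using nN n by (auto simp: of_nat_diff)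
  have m_eq: "real m = 3 * real N + 3 * (real N - real n) * (real n - 1)"
    using ys(2) real_N by (simp add: m_def xs_def rest_def len_rep n_def[symmetric] algebra_simps)
  have sum_eq: "sum_list (map k xs) = real N + (real N - real n) * real N"
  proof -
    have tri_sum: "sum_list (map k [p 0, p 1, p 2]) = 1" by (simp add: k_p)
    have "sum_list (map k xs) = 1 + (real (N - 1) * 1 + (real (3 * (N - n) - 1) * (real N / 3) + real N / 3))"
      by (simp only: xs_def rest_def map_append sum_list_append sum_rep tri_sum ys(3) N)
    also have "\<dots> = real N + (real N - real n) * real N"
      unfolding real_N by (simp add: algebra_simps)
    finally show ?thesis .
  qed
  have mean: "3 * real n * sum_list (map k xs) = real N * real m"
    unfolding m_eq sum_eq by (simp add: algebra_simps)
  have m0: "0 < m" by (simp add: m_def xs_def)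
  define v where "v i = xs ! (i mod m)" for i
  define \<beta> where "\<beta> i = sgn (v i)" for i
  have path: "point_path f P \<beta> v" 
    using loop_at_path[OF xs] unfolding v_def[abs_def] \<beta>_def[abs_def] m_def .
  have sum_v: "(\<Sum>i<m. k (v i)) = sum_list (map k xs)"
    by (simp add: v_def m_def sum_list_sum_nth lessThan_atLeast0)
  have m4: "3 < m" using rest by (cases rest) (auto simp: m_def xs_def loop_at_def)
  have v0: "v 0 = p 0" "v 1 = p 1" "v 2 = p 2" "v 3 = p 0"
    using m4 rest by (auto simp: v_def xs_def nth_append loop_at_def hd_conv_nth)
  obtain d where d: "least_path f P \<beta> d" using least_path_exists[OF fin path] by blast
  interpret tight_path f P \<beta> d by unfold_locales (use c d in auto)
  have dv: "below (d i) (v i)" for i using least_below[OF path] .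
  \<comment> \<open>A closest point has nothing of \<open>P\<close> below it but itself, so the
    least path keeps the initial triangle.\<close>
  have d_min: "d i = p j" if "v i = p j" "j < 3" for i j
  proof -
    have "d i \<in> b j"
      using mem_branch_iff[OF branch_numbering_in[OF b that(2)] pP(2)[OF that(2)]] dv[of i] that(1) d_T
      by (simp add: below_def)
    then have "below (p j) (d i)" using p_min[OF that(2) d_in] by blast
    then show ?thesis using below_antisym dv[of i] that(1) by metis
  qed
  \<comment> \<open>Passing from \<open>v\<close> to the least path keeps the branches of the points
    and of their images, hence the rotation.\<close>
  have v_bd: "branch_dist b (d i) (f (d i)) = k (v i)" for i
  proof -
    have "sgn (f (d i)) = \<beta> (Suc i)" using d_step[of i] sgn_d by (simp add: below_def)
    moreover have "sgn (f (v i)) = \<beta> (Suc i)" "v i \<in> P"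
      using path unfolding point_path_def below_def by metis+
    ultimately show ?thesis unfolding k_def
      using T d_in sgn_d by (intro branch_dist_sgn b) (auto simp: \<beta>_def)
  qed
  interpret periodic_tight_path f P \<beta> d m
  proof unfold_locales
    show "0 < m" by fact
    show "\<beta> (i + m) = \<beta> i" for i by (simp add: \<beta>_def v_def)
    show "\<exists>i. \<exists>e\<in>P. sgn e = \<beta> i \<and> cmod e < cmod (d i)"
    proof (rule ccontr)
      \<comment> \<open>Otherwise \<open>d\<close> would run through closest points only. These are
        black, so the mean would be 1/3.\<close>
      assume none: "\<not> (\<exists>i. \<exists>e\<in>P. sgn e = \<beta> i \<and> cmod e < cmod (d i))"
      have kv: "k (v i) = 1 / 3" for i
      proof -
        obtain j where j: "j < 3" "d i \<in> b j" using branch_numbering_ex[OF b d_T] by blast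
        have "below (p j) (d i)" using p_min[OF j(1) d_in j(2)] .
        moreover have "\<not> cmod (p j) < cmod (d i)"
          using none pP(1)[OF j(1)] \<open>below (p j) (d i)\<close> sgn_d by (auto simp: below_def)
        ultimately have "d i = p j" using below_less by metis
        then show ?thesis using v_bd[of i] k_p[OF j(1)] by (simp add: k_def)
      qed
      have "(\<Sum>i<m. k (v i)) = (\<Sum>i<m. 1 / 3)" by (intro sum.cong refl kv)
      then have sum3: "sum_list (map k xs) = real m / 3" using sum_v by simp
      have "real n * real m = real N * real m" using mean unfolding sum3 by simp
      then show False using nN m0 by simp
    qed
    show "\<exists>i. f (d i) \<noteq> d (Suc i)"
    proof (rule ccontr)
      \<comment> \<open>Otherwise the initial triangle would be an orbit and exhaust
        \<open>P\<close>, but the green point \<open>x\<close> is not among its points.\<close>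
      assume "\<not> (\<exists>i. f (d i) \<noteq> d (Suc i))"
      then have "f (d i) = d (Suc i)" for i by blast
      then have "f (d 0) = d 1" "f (d 1) = d 2" "f (d 2) = d 3" by (simp_all add: numeral_eq_Suc)
      then have f3: "f (p 0) = p 1" "f (p 1) = p 2" "f (p 2) = p 0" using d_min v0 by simp_all
      have "(f ^^ q) (p 0) \<in> {p 0, p 1, p 2}" for q by (induction q) (use f3 in auto)
      moreover obtain q where "x = (f ^^ q) (p 0)" using cycle_card(3)[OF c pP(1)[of 0]] x(1) by auto
      ultimately show False using xp[of 0] xp[of 1] xp[of 2] by auto
    qed
  qed
  have "branch_dist b (t i) (t (Suc i)) = k (v i)" for i
  proof -
    have "sgn (f (d i)) = \<beta> (Suc i)" using d_step[of i] sgn_d by (simp add: below_def)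
    then show ?thesis unfolding v_bd[symmetric]
      using T[OF d_in] shadow_T sgn_shadow sgn_d by (intro branch_dist_sgn b) auto
  qed
  then have "(\<Sum>i<m. branch_dist b (t i) (t (Suc i))) / real m = (\<Sum>y\<in>P. k y) / real n"
    unfolding N using mean sum_v m0 n by (simp add: field_simps)
  then have "(\<Sum>i<m. branch_dist b (t i) (t (Suc i))) / real m =
      (\<Sum>y\<in>P. branch_dist b y (f y)) / real (card P)"
    unfolding k_def n_def .
  moreover have "\<beta> 0 \<noteq> \<beta> (Suc 0)" using v0 p_sgn[of 0 1] by (simp add: \<beta>_def)
  ultimately show ?thesis using that[OF periodic_tight_path_axioms] by blast
qed

theorem lemma3p9:
  fixes b :: "nat \<Rightarrow> complex set" and \<pi> :: "cycle set"
  assumes "branch_numbering b"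
    and "triod_twist b \<pi>"
    and "canonical b \<pi>"
    and "rotation_number b \<pi> > 1 / 3"
  shows "\<forall>(f, P)\<in>\<pi>. \<forall>x\<in>P. \<not> green b f x"
proof clarify
  fix f P x assume fP: "(f, P) \<in> \<pi>" and x: "x \<in> P" "green b f x"
  have \<pi>: "\<pi> \<in> patterns" using assms(2) by (simp add: triod_twist_def)
  have c: "(f, P) \<in> cycles"
    using \<pi> fP patterns_equiv[OF \<pi> fP fP] by (auto simp: cycle_equiv_def)
  have \<rho>: "rotation_number b \<pi> = (\<Sum>y\<in>P. branch_dist b y (f y)) / real (card P)"
    using rotation_number_eq[OF assms(1) \<pi> fP x(1)] rotation_pair_sum[OF c x(1)] by simp
  have "\<forall>i<3. \<exists>p. p \<in> P \<inter> b i \<and> (\<forall>y\<in>P \<inter> b i. cmod p \<le> cmod y) \<and> black b f p"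
    using assms(3) fP unfolding canonical_def by blast
  then obtain p where p: "\<And>i. i < 3 \<Longrightarrow> p i \<in> P \<inter> b i \<and> (\<forall>y\<in>P \<inter> b i. cmod (p i) \<le> cmod y) \<and> black b f (p i)"
    by metis
  obtain \<beta> d m where d: "periodic_tight_path f P \<beta> d m" "\<beta> 0 \<noteq> \<beta> (Suc 0)"
    and mean: "(\<Sum>i<m. branch_dist b (shadow f d i) (shadow f d (Suc i))) / real m = rotation_number b \<pi>"
    using green_tight_path[OF assms(1) c p x] assms(4) unfolding \<rho> by blast
  define B where "B = cycle_equiv `` {(f, range (shadow f d))}"
  note B = forces_shadow[OF \<pi> fP d, folded B_def]
  have "rotation_number b B = rotation_number b \<pi>"
    using periodic_tight_path.rotation_number_shadow[OF d(1) assms(1) B(1,2)] mean by simp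
  then show False using assms(2) B unfolding triod_twist_def by blast
qed

end
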